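(* Let $\mathbb{N}_{\vee}$ be the semigroup $\mathbb{N}$ with multiplication $m\vee n=\max\{m,n\}$. Then the semigroup algebra $\ell^1(\mathbb{N}_\vee)$ is not Johnson pseudo-contractible, but it is pseudo-amenable and approximately amenable. Moreover, the second dual $\ell^1(\mathbb{N}_\vee)^{**}$ (with the first Arens product) is not Johnson pseudo-contractible.
   Context: $\ell^1(S)$ is the complex Banach algebra of absolutely summable functions on a semigroup $S$ with the $\ell^1$-norm and convolution product (determined by $\delta_s*\delta_t=\delta_{st}$). For a Banach algebra $A$, let $A\otimes_p A$ be the (completed) projective tensor product, a Banach $A$-bimodule with actions determined by $a\cdot(b\otimes c)=ab\otimes c$ and $(b\otimes c)\cdot a=b\otimes ca$, and let $\pi_A:A\otimes_p A\to A$ be the bounded linear map determined by $\pi_A(a\otimes b)=ab$. The biduals $A^{**}$ and $(A\otimes_p A)^{**}$ carry the induced bidual $A$-bimodule structures, and $A$ is regarded as canonically embedded in $A^{**}$. $A$ is Johnson pseudo-contractible if there is a (not necessarily bounded) net $(m_\alpha)$ in $(A\otimes_p A)^{**}$ such that $a\cdot m_\alpha=m_\alpha\cdot a$ for all $\alpha$ and $\pi_A^{**}(m_\alpha)a-a\to 0$ in norm, for every $a\in A$. $A$ is pseudo-amenable if there is a (not necessarily bounded) net $(m_\alpha)$ in $A\otimes_p A$ such that $a\cdot m_\alpha-m_\alpha\cdot a\to 0$ and $\pi_A(m_\alpha)a-a\to 0$ in norm, for every $a\in A$. $A$ is approximately amenable if and only if its unitization $A^\sharp$ is pseudo-amenable.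 The first Arens product on $A^{**}$ is given by $(F\square H)(f)=F(Hf)$, where $(Hf)(a)=H(fa)$ and $(fa)(b)=f(ab)$, for $F,H\in A^{**}$, $f\in A^*$, $a,b\in A$. *)

theory Defs
  imports "HOL-Analysis.Analysis"
begin

section \<open>Complex Banach spaces and algebras\<close>

class scaleC =
  fixes scaleC :: "complex \<Rightarrow> 'a \<Rightarrow> 'a" (infixr \<open>*\<^sub>C\<close> 75)

class complex_vector = scaleC + real_vector +
  assumes scaleC_add_right: "c *\<^sub>C (x + y) = c *\<^sub>C x + c *\<^sub>C y"
    and scaleC_add_left: "(c + d) *\<^sub>C x = c *\<^sub>C x + d *\<^sub>C x"
    and scaleC_scaleC: "c *\<^sub>C d *\<^sub>C x = (c * d) *\<^sub>C x"
    and scaleR_scaleC: "r *\<^sub>R x = complex_of_real r *\<^sub>C x"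

class complex_normed_vector = complex_vector + real_normed_vector +
  assumes norm_scaleC: "norm (c *\<^sub>C x) = norm c * norm x"

class complex_banach = complex_normed_vector + complete_space

text \<open>Not assumed to be unital or commutative.\<close>
class complex_banach_algebra = complex_banach + real_normed_algebra +
  assumes mult_scaleC_left: "(c *\<^sub>C x) * y = c *\<^sub>C (x * y)"
    and mult_scaleC_right: "x * (c *\<^sub>C y) = c *\<^sub>C (x * y)"

subclass (in complex_banach) banach ..

instantiation complex :: complex_banach_algebra
begin
definition scaleC_complex :: "complex \<Rightarrow> complex \<Rightarrow> complex"
  where "scaleC_complex c z = c * z"
instance
  by standard (auto simp: scaleC_complex_def algebra_simps norm_mult scaleR_conv_of_real)
end

lemma scaleC_one [simp]: "1 *\<^sub>C (x::'a::complex_vector) = x"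
  using scaleR_scaleC[of 1 x] by simp

lemma scaleC_zero_left [simp]: "0 *\<^sub>C (x::'a::complex_vector) = 0"
  using scaleR_scaleC[of 0 x] by simp

lemma scaleC_zero_right [simp]: "c *\<^sub>C (0::'a::complex_vector) = 0"
  using scaleC_add_right[of c "0::'a" 0] by simp

lemma scaleC_minus_left: "(- c) *\<^sub>C (x::'a::complex_vector) = - (c *\<^sub>C x)"
proof -
  have "(- c) *\<^sub>C x + c *\<^sub>C x = 0"
    by (simp flip: scaleC_add_left)
  then show ?thesis by (simp add: eq_neg_iff_add_eq_0)
qed

lemma scaleC_minus_right: "c *\<^sub>C (- x::'a::complex_vector) = - (c *\<^sub>C x)"
proof -
  have "c *\<^sub>C (- x) + c *\<^sub>C x = 0"
    by (simp flip: scaleC_add_right)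
  then show ?thesis by (simp add: eq_neg_iff_add_eq_0)
qed

lemma scaleC_diff_right: "c *\<^sub>C (x - y::'a::complex_vector) = c *\<^sub>C x - c *\<^sub>C y"
  using scaleC_add_right[of c x "- y"] by (simp add: scaleC_minus_right)

definition bounded_clinear :: "('a::complex_normed_vector \<Rightarrow> 'b::complex_normed_vector) \<Rightarrow> bool"
  where "bounded_clinear T \<longleftrightarrow> bounded_linear T \<and> (\<forall>c x. T (c *\<^sub>C x) = c *\<^sub>C T x)"

definition bounded_cbilinear ::
    "('a::complex_normed_vector \<Rightarrow> 'b::complex_normed_vector \<Rightarrow> 'c::complex_normed_vector) \<Rightarrow> bool"
  where "bounded_cbilinear \<beta> \<longleftrightarrow> bounded_bilinear \<beta> \<and>
    (\<forall>c x y. \<beta> (c *\<^sub>C x) y = c *\<^sub>C \<beta> x y \<and> \<beta> x (c *\<^sub>C y) = c *\<^sub>C \<beta> x y)"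

lemma bounded_clinearI:
  assumes "\<And>x y. T (x + y) = T x + T y" "\<And>c x. T (c *\<^sub>C x) = c *\<^sub>C T x"
    and "\<And>x. norm (T x) \<le> norm x * K"
  shows "bounded_clinear T"
  unfolding bounded_clinear_def
  by (intro conjI bounded_linear_intro[of T K]) (auto simp: assms scaleR_scaleC)

lemma bounded_clinear_linear: "bounded_clinear T \<Longrightarrow> bounded_linear T"
  by (simp add: bounded_clinear_def)

lemma bounded_clinear_scaleC: "bounded_clinear T \<Longrightarrow> T (c *\<^sub>C x) = c *\<^sub>C T x"
  by (simp add: bounded_clinear_def)

lemma bounded_clinear_compose:
  "bounded_clinear S \<Longrightarrow> bounded_clinear T \<Longrightarrow> bounded_clinear (\<lambda>x. S (T x))"
  by (auto simp: bounded_clinear_def intro: bounded_linear_compose)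

lemma bounded_cbilinear_left: "bounded_cbilinear \<beta> \<Longrightarrow> bounded_clinear (\<lambda>x. \<beta> x y)"
  by (auto simp: bounded_clinear_def bounded_cbilinear_def intro: bounded_bilinear.bounded_linear_left)

lemma bounded_cbilinear_right: "bounded_cbilinear \<beta> \<Longrightarrow> bounded_clinear (\<lambda>y. \<beta> x y)"
  by (auto simp: bounded_clinear_def bounded_cbilinear_def intro: bounded_bilinear.bounded_linear_right)

lemma bounded_cbilinear_mult:
  "bounded_cbilinear ((*) :: 'a::complex_banach_algebra \<Rightarrow> 'a \<Rightarrow> 'a)"
  by (auto simp: bounded_cbilinear_def mult_scaleC_left mult_scaleC_right bounded_bilinear_mult)

section \<open>The dual of a Banach space\<close>

typedef (overloaded) 'a cdual = "{f :: 'a::complex_normed_vector \<Rightarrow> complex. bounded_clinear f}"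
  morphisms cdual_apply Cdual
  by (rule exI[of _ "\<lambda>_. 0"]) (auto intro!: bounded_clinearI[where K = 0])

setup_lifting type_definition_cdual

lemma cdual_eqI: "(\<And>x. cdual_apply f x = cdual_apply g x) \<Longrightarrow> f = g"
  by (simp add: cdual_apply_inject[symmetric] fun_eq_iff)

lemma bounded_clinear_cdual_apply: "bounded_clinear (cdual_apply f)"
  using cdual_apply[of f] by simp

lemma bounded_linear_cdual_apply: "bounded_linear (cdual_apply f)"
  by (simp add: bounded_clinear_cdual_apply bounded_clinear_linear)

lemma cdual_apply_Cdual: "bounded_clinear f \<Longrightarrow> cdual_apply (Cdual f) = f"
  by (simp add: Cdual_inverse)

instantiation cdual :: (complex_normed_vector) complex_normed_vector
begin

lift_definition zero_cdual :: "'a cdual" is "\<lambda>_. 0"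
  by (auto intro!: bounded_clinearI[where K = 0])

lift_definition plus_cdual :: "'a cdual \<Rightarrow> 'a cdual \<Rightarrow> 'a cdual" is "\<lambda>f g x. f x + g x"
  by (auto simp: bounded_clinear_def bounded_linear_add scaleC_add_right)

lift_definition uminus_cdual :: "'a cdual \<Rightarrow> 'a cdual" is "\<lambda>f x. - f x"
  by (auto simp: bounded_clinear_def bounded_linear_minus scaleC_minus_right)

lift_definition minus_cdual :: "'a cdual \<Rightarrow> 'a cdual \<Rightarrow> 'a cdual" is "\<lambda>f g x. f x - g x"
  by (auto simp: bounded_clinear_def bounded_linear_sub scaleC_diff_right)

lift_definition scaleC_cdual :: "complex \<Rightarrow> 'a cdual \<Rightarrow> 'a cdual" is "\<lambda>c f x. c * f x"
  by (auto simp: bounded_clinear_def scaleC_complex_def intro: bounded_linear_const_mult)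

lift_definition scaleR_cdual :: "real \<Rightarrow> 'a cdual \<Rightarrow> 'a cdual" is "\<lambda>r f x. complex_of_real r * f x"
  by (auto simp: bounded_clinear_def scaleC_complex_def intro: bounded_linear_const_mult)

lift_definition norm_cdual :: "'a cdual \<Rightarrow> real" is onorm .

definition dist_cdual :: "'a cdual \<Rightarrow> 'a cdual \<Rightarrow> real" where "dist_cdual f g = norm (f - g)"

definition sgn_cdual :: "'a cdual \<Rightarrow> 'a cdual" where "sgn_cdual f = scaleR (inverse (norm f)) f"

definition uniformity_cdual :: "('a cdual \<times> 'a cdual) filter"
  where "uniformity_cdual = (INF e\<in>{0 <..}. principal {(x, y). dist x y < e})"

definition open_cdual :: "'a cdual set \<Rightarrow> bool"
  where "open_cdual U \<longleftrightarrow> (\<forall>x\<in>U. \<forall>\<^sub>F (x', y) in uniformity. x' = x \<longrightarrow> y \<in> U)"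

instance
proof
  fix f g h :: "'a cdual" and c d :: complex and r s :: real
  show "f + g + h = f + (g + h)" by transfer (simp add: algebra_simps)
  show "f + g = g + f" by transfer (simp add: algebra_simps)
  show "0 + f = f" by transfer simp
  show "- f + f = 0" by transfer simp
  show "f - g = f + - g" by transfer simp
  show "r *\<^sub>R (f + g) = r *\<^sub>R f + r *\<^sub>R g" by transfer (simp add: algebra_simps)
  show "(r + s) *\<^sub>R f = r *\<^sub>R f + s *\<^sub>R f" by transfer (simp add: algebra_simps)
  show "r *\<^sub>R s *\<^sub>R f = (r * s) *\<^sub>R f" by transfer (simp add: algebra_simps)
  show "1 *\<^sub>R f = f" by transfer simp
  show "c *\<^sub>C (f + g) = c *\<^sub>C f + c *\<^sub>C g" by transfer (simp add: algebra_simps)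
  show "(c + d) *\<^sub>C f = c *\<^sub>C f + d *\<^sub>C f" by transfer (simp add: algebra_simps)
  show "c *\<^sub>C d *\<^sub>C f = (c * d) *\<^sub>C f" by transfer (simp add: algebra_simps)
  show "r *\<^sub>R f = complex_of_real r *\<^sub>C f" by transfer simp
  show "dist f g = norm (f - g)" by (rule dist_cdual_def)
  show "sgn f = scaleR (inverse (norm f)) f" by (rule sgn_cdual_def)
  show "(uniformity :: ('a cdual \<times> 'a cdual) filter) = (INF e\<in>{0 <..}. principal {(x, y). dist x y < e})"
    by (rule uniformity_cdual_def)
  show "open U \<longleftrightarrow> (\<forall>x\<in>U. \<forall>\<^sub>F (x', y) in uniformity. x' = x \<longrightarrow> y \<in> U)" for U :: "'a cdual set"
    by (rule open_cdual_def)
  show "(norm f = 0) = (f = 0)"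
    by transfer (auto simp: onorm_eq_0 bounded_clinear_def fun_eq_iff)
  show "norm (f + g) \<le> norm f + norm g"
    by transfer (auto simp: bounded_clinear_def intro: onorm_triangle)
  show n: "norm (c *\<^sub>C f) = norm c * norm f" for c
  proof transfer
    fix c and f :: "'a \<Rightarrow> complex"
    assume "bounded_clinear f"
    then have f: "bounded_linear f" by (rule bounded_clinear_linear)
    have le: "onorm (\<lambda>x. c * g x) \<le> norm c * onorm g" if "bounded_linear g" for c and g :: "'a \<Rightarrow> complex"
      by (intro onorm_bound mult_nonneg_nonneg norm_ge_zero onorm_pos_le that)
        (auto simp: norm_mult mult.assoc intro!: mult_left_mono onorm[OF that])
    show "onorm (\<lambda>x. c * f x) = norm c * onorm f"
    proof (cases "c = 0")
      case True
      then show ?thesis by (simp add: onorm_zero)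
    next
      case False
      have "onorm f = onorm (\<lambda>x. inverse c * (c * f x))"
        using False by (simp add: field_simps)
      also have "\<dots> \<le> norm (inverse c) * onorm (\<lambda>x. c * f x)"
        by (intro le bounded_linear_const_mult f)
      finally have "norm c * onorm f \<le> onorm (\<lambda>x. c * f x)"
        using False by (simp add: norm_divide norm_inverse field_simps)
      then show ?thesis using le[OF f, of c] by simp
    qed
  qed
  have "r *\<^sub>R f = complex_of_real r *\<^sub>C f" by transfer simp
  then show "norm (r *\<^sub>R f) = \<bar>r\<bar> * norm f" by (simp add: n)
qed

end

lemma norm_cdual_apply_le: "norm (cdual_apply f x) \<le> norm f * norm x"
  unfolding norm_cdual.rep_eq by (rule onorm[OF bounded_linear_cdual_apply])

lemma norm_cdual_bound:
  "0 \<le> K \<Longrightarrow> (\<And>x. norm (cdual_apply f x) \<le> K * norm x) \<Longrightarrow> norm f \<le> K"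
  unfolding norm_cdual.rep_eq by (rule onorm_bound)

instance cdual :: (complex_normed_vector) complex_banach
proof
  fix X :: "nat \<Rightarrow> 'a cdual"
  assume X: "Cauchy X"
  define Y where "Y n = Blinfun (cdual_apply (X n))" for n
  have Y: "blinfun_apply (Y n) = cdual_apply (X n)" for n
    unfolding Y_def by (rule bounded_linear_Blinfun_apply[OF bounded_linear_cdual_apply])
  have dY: "dist (X m) (X n) = dist (Y m) (Y n)" for m n
    by (simp add: dist_norm norm_blinfun.rep_eq norm_cdual.rep_eq minus_cdual.rep_eq
        minus_blinfun.rep_eq Y)
  have "Cauchy Y" using X by (simp add: Cauchy_def dY)
  then obtain L where L: "Y \<longlonglongrightarrow> L" using Cauchy_convergent convergent_def by blast
  have pt: "(\<lambda>n. cdual_apply (X n) x) \<longlonglongrightarrow> blinfun_apply L x" for x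
    using blinfun.tendsto[OF L tendsto_const, of x] by (simp add: Y)
  have "blinfun_apply L (c *\<^sub>C x) = c *\<^sub>C blinfun_apply L x" for c x
  proof (rule LIMSEQ_unique[OF pt])
    show "(\<lambda>n. cdual_apply (X n) (c *\<^sub>C x)) \<longlonglongrightarrow> c *\<^sub>C blinfun_apply L x"
      using tendsto_mult[OF tendsto_const pt, of c x]
      by (simp add: bounded_clinear_scaleC[OF bounded_clinear_cdual_apply] scaleC_complex_def)
  qed
  then have cl: "bounded_clinear (blinfun_apply L)"
    by (simp add: bounded_clinear_def blinfun.bounded_linear_right)
  have "norm (X n - Cdual (blinfun_apply L)) = norm (Y n - L)" for n
    by (simp add: norm_blinfun.rep_eq norm_cdual.rep_eq minus_cdual.rep_eq
        minus_blinfun.rep_eq Y cdual_apply_Cdual[OF cl])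
  then have "X \<longlonglongrightarrow> Cdual (blinfun_apply L)"
    using L by (simp add: LIMSEQ_iff)
  then show "convergent X" by (auto simp: convergent_def)
qed

section \<open>The projective tensor product\<close>

text \<open>
  The algebraic tensor product: a list of pairs represents the sum of the elementary tensors of
  its entries, and two lists are identified by the congruence generated by the bilinearity
  relations.
\<close>

inductive tensor_eq :: "('a::complex_vector \<times> 'b::complex_vector) list \<Rightarrow> ('a \<times> 'b) list \<Rightarrow> bool"
  where
    refl: "tensor_eq xs xs"
  | sym: "tensor_eq xs ys \<Longrightarrow> tensor_eq ys xs"
  | trans: "tensor_eq xs ys \<Longrightarrow> tensor_eq ys zs \<Longrightarrow> tensor_eq xs zs"
  | append: "tensor_eq xs xs' \<Longrightarrow> tensor_eq ys ys' \<Longrightarrow> tensor_eq (xs @ ys) (xs' @ ys')"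
  | commute: "tensor_eq (xs @ ys) (ys @ xs)"
  | zero: "tensor_eq [(0, b)] []"
  | add_left: "tensor_eq [(a + a', b)] [(a, b), (a', b)]"
  | add_right: "tensor_eq [(a, b + b')] [(a, b), (a, b')]"
  | scaleC: "tensor_eq [(c *\<^sub>C a, b)] [(a, c *\<^sub>C b)]"

quotient_type (overloaded) ('a, 'b) atensor = "('a::complex_vector \<times> 'b::complex_vector) list" / tensor_eq
  by (intro equivpI reflpI sympI transpI) (auto intro: tensor_eq.intros)

lift_definition atensor :: "'a::complex_vector \<Rightarrow> 'b::complex_vector \<Rightarrow> ('a, 'b) atensor"
  is "\<lambda>a b. [(a, b)]" .

lemma tensor_eq_scale:
  assumes "tensor_eq xs ys"
  shows "tensor_eq (map (\<lambda>(a, b). (c *\<^sub>C a, b)) xs) (map (\<lambda>(a, b). (c *\<^sub>C a, b)) ys)"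
  using assms
proof induction
  case (scaleC d a b)
  have "c *\<^sub>C d *\<^sub>C a = d *\<^sub>C c *\<^sub>C a" by (simp add: scaleC_scaleC mult.commute)
  then show ?case by (simp add: tensor_eq.scaleC)
qed (auto intro: tensor_eq.intros simp: scaleC_add_right)

lemma tensor_eq_scale_add:
  "tensor_eq (map (\<lambda>(a, b). ((c + d) *\<^sub>C a, b)) xs)
     (map (\<lambda>(a, b). (c *\<^sub>C a, b)) xs @ map (\<lambda>(a, b). (d *\<^sub>C a, b)) xs)"
proof (induction xs)
  case (Cons x xs)
  obtain a b where x: "x = (a, b)" by (cases x)
  let ?m = "\<lambda>c. map (\<lambda>(a, b). (c *\<^sub>C a, b)) xs"
  have "tensor_eq ([((c + d) *\<^sub>C a, b)] @ ?m (c + d)) ([(c *\<^sub>C a, b), (d *\<^sub>C a, b)] @ (?m c @ ?m d))"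
    by (rule tensor_eq.append) (simp only: scaleC_add_left, rule tensor_eq.add_left, rule Cons.IH)
  moreover have "tensor_eq ([(c *\<^sub>C a, b)] @ (([(d *\<^sub>C a, b)] @ ?m c) @ ?m d))
      ([(c *\<^sub>C a, b)] @ ((?m c @ [(d *\<^sub>C a, b)]) @ ?m d))"
    by (intro tensor_eq.append tensor_eq.refl tensor_eq.commute)
  ultimately show ?case using x by (auto intro: tensor_eq.trans)
qed (auto intro: tensor_eq.intros)

lemma tensor_eq_zero: "tensor_eq (map (\<lambda>(a, b). (0, b)) xs) []"
proof (induction xs)
  case (Cons x xs)
  then show ?case
    using tensor_eq.append[OF tensor_eq.zero Cons] by (cases x) auto
qed (auto intro: tensor_eq.intros)

instantiation atensor :: (complex_vector, complex_vector) complex_vector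
begin

lift_definition zero_atensor :: "('a, 'b) atensor" is "[]" .

lift_definition plus_atensor :: "('a, 'b) atensor \<Rightarrow> ('a, 'b) atensor \<Rightarrow> ('a, 'b) atensor" is "(@)"
  by (rule tensor_eq.append)

lift_definition scaleC_atensor :: "complex \<Rightarrow> ('a, 'b) atensor \<Rightarrow> ('a, 'b) atensor"
  is "\<lambda>c. map (\<lambda>(a, b). (c *\<^sub>C a, b))"
  by (rule tensor_eq_scale)

definition uminus_atensor :: "('a, 'b) atensor \<Rightarrow> ('a, 'b) atensor"
  where "uminus_atensor u = (- 1) *\<^sub>C u"

definition minus_atensor :: "('a, 'b) atensor \<Rightarrow> ('a, 'b) atensor \<Rightarrow> ('a, 'b) atensor"
  where "minus_atensor u v = u + - v"

definition scaleR_atensor :: "real \<Rightarrow> ('a, 'b) atensor \<Rightarrow> ('a, 'b) atensor"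
  where "scaleR_atensor r u = complex_of_real r *\<^sub>C u"

instance
proof
  fix u v w :: "('a, 'b) atensor" and c d :: complex and r s :: real
  show "u + v + w = u + (v + w)" by transfer (simp add: tensor_eq.refl)
  show "u + v = v + u" by transfer (rule tensor_eq.commute)
  show "0 + u = u" by transfer (simp add: tensor_eq.refl)
  show add_right: "c *\<^sub>C (u + v) = c *\<^sub>C u + c *\<^sub>C v" for c and u v :: "('a, 'b) atensor"
    by transfer (simp add: tensor_eq.refl)
  show add_left: "(c + d) *\<^sub>C u = c *\<^sub>C u + d *\<^sub>C u" for c d and u :: "('a, 'b) atensor"
    by transfer (rule tensor_eq_scale_add)
  show scaleC: "c *\<^sub>C d *\<^sub>C u = (c * d) *\<^sub>C u" for c d and u :: "('a, 'b) atensor"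
    by transfer (simp add: scaleC_scaleC o_def case_prod_unfold tensor_eq.refl)
  have one: "1 *\<^sub>C u = u" for u :: "('a, 'b) atensor"
    by transfer (simp add: tensor_eq.refl)
  have "0 *\<^sub>C u = 0"
    by transfer (simp add: tensor_eq_zero)
  then show "- u + u = 0"
    using add_left[of "- 1" 1 u] by (simp add: uminus_atensor_def one)
  show "u - v = u + - v" by (rule minus_atensor_def)
  show "r *\<^sub>R u = complex_of_real r *\<^sub>C u" by (rule scaleR_atensor_def)
  show "r *\<^sub>R (u + v) = r *\<^sub>R u + r *\<^sub>R v" by (simp add: scaleR_atensor_def add_right)
  show "(r + s) *\<^sub>R u = r *\<^sub>R u + s *\<^sub>R u" by (simp add: scaleR_atensor_def add_left)
  show "r *\<^sub>R s *\<^sub>R u = (r * s) *\<^sub>R u" by (simp add: scaleR_atensor_def scaleC)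
  show "1 *\<^sub>R u = u" by (simp add: scaleR_atensor_def one)
qed

end

definition list_norm :: "('a::complex_normed_vector \<times> 'b::complex_normed_vector) list \<Rightarrow> real"
  where "list_norm xs = (\<Sum>(a, b)\<leftarrow>xs. norm a * norm b)"

definition proj_norm :: "('a::complex_normed_vector, 'b::complex_normed_vector) atensor \<Rightarrow> real"
  where "proj_norm u = Inf {(\<Sum>(a, b)\<leftarrow>xs. norm a * norm b) | xs. u = (\<Sum>(a, b)\<leftarrow>xs. atensor a b)}"

lemma list_norm_nonneg: "list_norm xs \<ge> 0"
  unfolding list_norm_def by (auto intro!: sum_list_nonneg)

lemma sum_list_atensor: "(\<Sum>(a, b)\<leftarrow>xs. atensor a b) = abs_atensor xs"
proof (induction xs)
  case Nil
  then show ?case by (simp add: zero_atensor.abs_eq)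
next
  case (Cons x xs)
  obtain a b where x: "x = (a, b)" by (cases x)
  show ?case
    unfolding x using Cons by (simp add: atensor.abs_eq plus_atensor.abs_eq)
qed

lemma atensor_sum_ex: "\<exists>xs. u = (\<Sum>(a, b)\<leftarrow>xs. atensor a b)"
  by (metis sum_list_atensor Quotient_atensor Quotient_abs_rep)

lemma proj_norm_le: "proj_norm (\<Sum>(a, b)\<leftarrow>xs. atensor a b) \<le> list_norm xs"
  unfolding proj_norm_def
  by (rule cInf_lower) (auto intro!: bdd_belowI[of _ 0] list_norm_nonneg simp flip: list_norm_def)

lemma proj_norm_greatest:
  assumes "\<And>xs. u = (\<Sum>(a, b)\<leftarrow>xs. atensor a b) \<Longrightarrow> K \<le> list_norm xs"
  shows "K \<le> proj_norm u"
  unfolding proj_norm_def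
  by (rule cInf_greatest) (use atensor_sum_ex[of u] assms in \<open>auto simp flip: list_norm_def\<close>)

lemma proj_norm_approx:
  assumes "0 < e"
  obtains xs where "u = (\<Sum>(a, b)\<leftarrow>xs. atensor a b)" "list_norm xs < proj_norm u + e"
proof -
  have "\<not> proj_norm u + e \<le> proj_norm u" using assms by simp
  then show ?thesis using proj_norm_greatest[of u "proj_norm u + e"] that by force
qed

lemma proj_norm_nonneg: "proj_norm u \<ge> 0"
  by (rule proj_norm_greatest) (rule list_norm_nonneg)

lemma proj_norm_zero [simp]: "proj_norm (0 :: ('a::complex_normed_vector, 'b::complex_normed_vector) atensor) = 0"
  using proj_norm_le[of "[] :: ('a \<times> 'b) list"] proj_norm_nonneg[of "0 :: ('a, 'b) atensor"] by (simp add: list_norm_def)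

lemma proj_norm_atensor_le: "proj_norm (atensor a b) \<le> norm a * norm b"
  using proj_norm_le[of "[(a, b)]"] by (simp add: list_norm_def)

lemma proj_norm_triangle: "proj_norm (u + v) \<le> proj_norm u + proj_norm v"
proof (rule field_le_epsilon)
  fix e :: real assume "0 < e"
  then have "0 < e / 2" by simp
  obtain xs ys where "u = (\<Sum>(a, b)\<leftarrow>xs. atensor a b)" "list_norm xs < proj_norm u + e / 2"
    and "v = (\<Sum>(a, b)\<leftarrow>ys. atensor a b)" "list_norm ys < proj_norm v + e / 2"
    using proj_norm_approx[OF \<open>0 < e / 2\<close>] by metis
  then show "proj_norm (u + v) \<le> proj_norm u + proj_norm v + e"
    using proj_norm_le[of "xs @ ys"] by (simp add: list_norm_def)
qed

lemma proj_norm_scaleC_le: "proj_norm (c *\<^sub>C u) \<le> norm c * proj_norm u"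
proof (cases "c = 0")
  case False
  have "proj_norm (c *\<^sub>C u) / norm c \<le> proj_norm u"
  proof (rule proj_norm_greatest)
    fix xs assume u: "u = (\<Sum>(a, b)\<leftarrow>xs. atensor a b)"
    let ?ys = "map (\<lambda>(a, b). (c *\<^sub>C a, b)) xs"
    have "c *\<^sub>C u = (\<Sum>(a, b)\<leftarrow>?ys. atensor a b)"
      by (simp add: u sum_list_atensor scaleC_atensor.abs_eq del: map_map)
    moreover have "list_norm ?ys = norm c * list_norm xs"
      by (simp add: list_norm_def o_def case_prod_unfold norm_scaleC mult.assoc flip: sum_list_const_mult)
    ultimately show "proj_norm (c *\<^sub>C u) / norm c \<le> list_norm xs"
      using proj_norm_le[of ?ys] False by (simp add: field_simps)
  qed
  then show ?thesis using False by (simp add: field_simps)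
qed simp

lemma proj_norm_scaleC: "proj_norm (c *\<^sub>C u) = norm c * proj_norm u"
proof (cases "c = 0")
  case False
  have "proj_norm u = proj_norm (inverse c *\<^sub>C c *\<^sub>C u)"
    using False by (simp add: scaleC_scaleC)
  also have "\<dots> \<le> norm (inverse c) * proj_norm (c *\<^sub>C u)" by (rule proj_norm_scaleC_le)
  finally have "norm c * proj_norm u \<le> proj_norm (c *\<^sub>C u)"
    using False by (simp add: norm_inverse norm_divide field_simps)
  then show ?thesis using proj_norm_scaleC_le[of c u] by simp
qed simp

lemma proj_norm_minus: "proj_norm (- u) = proj_norm u"
  using proj_norm_scaleC[of "- 1" u] by (simp add: uminus_atensor_def)

lemma proj_norm_minus_commute: "proj_norm (u - v) = proj_norm (v - u)"
  using proj_norm_minus[of "u - v"] by simp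

lemma proj_norm_diff_triangle: "proj_norm (u - w) \<le> proj_norm (u - v) + proj_norm (v - w)"
  using proj_norm_triangle[of "u - v" "v - w"] by simp

lemma proj_norm_diff_le: "\<bar>proj_norm u - proj_norm v\<bar> \<le> proj_norm (u - v)"
  using proj_norm_triangle[of "u - v" v] proj_norm_triangle[of "v - u" u]
    proj_norm_minus_commute[of u v] by simp

text \<open>
  Its completion for the projective norm, as a quotient of the space of Cauchy sequences.
  Here \<^const>\<open>proj_norm\<close> is only used as a seminorm; it is in fact a norm, so nothing of the
  algebraic tensor product is lost in the quotient.
\<close>

definition proj_Cauchy :: "(nat \<Rightarrow> ('a::complex_normed_vector, 'b::complex_normed_vector) atensor) \<Rightarrow> bool"
  where "proj_Cauchy X \<longleftrightarrow> (\<forall>e>0. \<exists>N. \<forall>m\<ge>N. \<forall>n\<ge>N. proj_norm (X m - X n) < e)"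

definition proj_rel :: "(nat \<Rightarrow> ('a::complex_normed_vector, 'b::complex_normed_vector) atensor) \<Rightarrow>
    (nat \<Rightarrow> ('a, 'b) atensor) \<Rightarrow> bool"
  where "proj_rel X Y \<longleftrightarrow> proj_Cauchy X \<and> proj_Cauchy Y \<and> (\<lambda>n. proj_norm (X n - Y n)) \<longlonglongrightarrow> 0"

lemma proj_Cauchy_const: "proj_Cauchy (\<lambda>_. u)"
  by (simp add: proj_Cauchy_def)

lemma proj_Cauchy_dominated:
  assumes X: "proj_Cauchy X" and Y: "proj_Cauchy Y" and K: "K \<ge> 0"
    and le: "\<And>m n. proj_norm (Z m - Z n) \<le> K * (proj_norm (X m - X n) + proj_norm (Y m - Y n))"
  shows "proj_Cauchy Z"
  unfolding proj_Cauchy_def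
proof (intro allI impI)
  fix e :: real assume "e > 0"
  define d where "d = e / (2 * (K + 1))"
  have d: "d > 0" using \<open>e > 0\<close> K by (simp add: d_def)
  obtain M where M: "\<And>m n. m \<ge> M \<Longrightarrow> n \<ge> M \<Longrightarrow> proj_norm (X m - X n) < d"
    using X d unfolding proj_Cauchy_def by blast
  obtain N where N: "\<And>m n. m \<ge> N \<Longrightarrow> n \<ge> N \<Longrightarrow> proj_norm (Y m - Y n) < d"
    using Y d unfolding proj_Cauchy_def by blast
  have "proj_norm (Z m - Z n) < e" if "m \<ge> max M N" "n \<ge> max M N" for m n
  proof -
    have "proj_norm (Z m - Z n) \<le> K * (proj_norm (X m - X n) + proj_norm (Y m - Y n))" by (rule le)
    also have "\<dots> \<le> K * (2 * d)"
      using M[of m n] N[of m n] that K by (intro mult_left_mono) auto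
    also have "\<dots> < (K + 1) * (2 * d)" using d by simp
    also have "\<dots> = e" using K by (simp add: d_def field_simps)
    finally show ?thesis .
  qed
  then show "\<exists>N. \<forall>m\<ge>N. \<forall>n\<ge>N. proj_norm (Z m - Z n) < e" by blast
qed

lemma proj_Cauchy_add:
  assumes "proj_Cauchy X" "proj_Cauchy Y"
  shows "proj_Cauchy (\<lambda>n. X n + Y n)"
proof (rule proj_Cauchy_dominated[OF assms, of 1])
  show "proj_norm (X m + Y m - (X n + Y n)) \<le> 1 * (proj_norm (X m - X n) + proj_norm (Y m - Y n))" for m n
    using proj_norm_triangle[of "X m - X n" "Y m - Y n"] by (simp add: algebra_simps)
qed simp

lemma proj_Cauchy_scaleC:
  assumes "proj_Cauchy X"
  shows "proj_Cauchy (\<lambda>n. c *\<^sub>C X n)"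
proof (rule proj_Cauchy_dominated[OF assms assms, of "norm c"])
  show "proj_norm (c *\<^sub>C X m - c *\<^sub>C X n) \<le> norm c * (proj_norm (X m - X n) + proj_norm (X m - X n))" for m n
    by (simp add: proj_norm_scaleC proj_norm_nonneg mult_left_mono flip: scaleC_diff_right)
qed simp

lemma proj_Cauchy_norm:
  assumes "proj_Cauchy X"
  shows "convergent (\<lambda>n. proj_norm (X n))"
proof -
  have "Cauchy (\<lambda>n. proj_norm (X n))"
  proof (rule metric_CauchyI)
    fix e :: real assume "e > 0"
    then obtain N where N: "\<And>m n. m \<ge> N \<Longrightarrow> n \<ge> N \<Longrightarrow> proj_norm (X m - X n) < e"
      using assms unfolding proj_Cauchy_def by blast
    have "dist (proj_norm (X m)) (proj_norm (X n)) < e" if "m \<ge> N" "n \<ge> N" for m n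
      using N[OF that] proj_norm_diff_le[of "X m" "X n"] by (simp add: dist_real_def)
    then show "\<exists>N. \<forall>m\<ge>N. \<forall>n\<ge>N. dist (proj_norm (X m)) (proj_norm (X n)) < e" by blast
  qed
  then show ?thesis by (simp add: Cauchy_convergent_iff)
qed

lemma proj_rel_dominated:
  assumes X: "(\<lambda>n. proj_norm (X n)) \<longlonglongrightarrow> 0" and Y: "(\<lambda>n. proj_norm (Y n)) \<longlonglongrightarrow> 0"
    and le: "\<And>n. proj_norm (Z n) \<le> K * (proj_norm (X n) + proj_norm (Y n))"
  shows "(\<lambda>n. proj_norm (Z n)) \<longlonglongrightarrow> 0"
proof (rule Lim_null_comparison[OF always_eventually])
  show "(\<lambda>n. K * (proj_norm (X n) + proj_norm (Y n))) \<longlonglongrightarrow> 0"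
    using tendsto_mult[OF tendsto_const tendsto_add[OF X Y], of K] by simp
qed (auto simp: proj_norm_nonneg le)

lemma part_equivp_proj_rel: "part_equivp (proj_rel :: _ \<Rightarrow> (nat \<Rightarrow> ('a::complex_normed_vector, 'b::complex_normed_vector) atensor) \<Rightarrow> _)"
proof (rule part_equivpI)
  show "\<exists>X. proj_rel X (X :: nat \<Rightarrow> ('a, 'b) atensor)"
    by (rule exI[of _ "\<lambda>_. 0"]) (simp add: proj_rel_def proj_Cauchy_const)
  show "symp (proj_rel :: (nat \<Rightarrow> ('a, 'b) atensor) \<Rightarrow> _)"
  proof (rule sympI)
    fix X Y :: "nat \<Rightarrow> ('a, 'b) atensor"
    assume "proj_rel X Y"
    then show "proj_rel Y X"
      unfolding proj_rel_def using proj_norm_minus_commute[of "X n" "Y n" for n] by simp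
  qed
  show "transp (proj_rel :: (nat \<Rightarrow> ('a, 'b) atensor) \<Rightarrow> _)"
  proof (rule transpI)
    fix X Y Z :: "nat \<Rightarrow> ('a, 'b) atensor"
    assume "proj_rel X Y" "proj_rel Y Z"
    moreover from this have "(\<lambda>n. proj_norm (X n - Z n)) \<longlonglongrightarrow> 0"
      by (simp add: proj_rel_def)
        (rule proj_rel_dominated[of "\<lambda>n. X n - Y n" "\<lambda>n. Y n - Z n" _ 1],
          simp_all add: proj_norm_diff_triangle)
    ultimately show "proj_rel X Z" by (auto simp: proj_rel_def)
  qed
qed

quotient_type (overloaded) ('a, 'b) ptensor =
    "nat \<Rightarrow> ('a::complex_normed_vector, 'b::complex_normed_vector) atensor" / partial: proj_rel
  by (rule part_equivp_proj_rel)

instantiation ptensor :: (complex_normed_vector, complex_normed_vector) complex_normed_vector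
begin

lift_definition zero_ptensor :: "('a, 'b) ptensor" is "\<lambda>_. 0"
  by (simp add: proj_rel_def proj_Cauchy_const)

lift_definition plus_ptensor :: "('a, 'b) ptensor \<Rightarrow> ('a, 'b) ptensor \<Rightarrow> ('a, 'b) ptensor"
  is "\<lambda>X Y n. X n + Y n"
proof -
  fix X X' Y Y' :: "nat \<Rightarrow> ('a, 'b) atensor"
  assume X: "proj_rel X X'" and Y: "proj_rel Y Y'"
  have "(\<lambda>n. proj_norm ((X n + Y n) - (X' n + Y' n))) \<longlonglongrightarrow> 0"
  proof (rule proj_rel_dominated[of "\<lambda>n. X n - X' n" "\<lambda>n. Y n - Y' n" _ 1])
    show "proj_norm ((X n + Y n) - (X' n + Y' n)) \<le> 1 * (proj_norm (X n - X' n) + proj_norm (Y n - Y' n))" for n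
      using proj_norm_triangle[of "X n - X' n" "Y n - Y' n"] by (simp add: algebra_simps)
  qed (use X Y in \<open>auto simp: proj_rel_def\<close>)
  then show "proj_rel (\<lambda>n. X n + Y n) (\<lambda>n. X' n + Y' n)"
    using X Y by (simp add: proj_rel_def proj_Cauchy_add)
qed

lift_definition scaleC_ptensor :: "complex \<Rightarrow> ('a, 'b) ptensor \<Rightarrow> ('a, 'b) ptensor"
  is "\<lambda>c X n. c *\<^sub>C X n"
proof -
  fix c :: complex and X X' :: "nat \<Rightarrow> ('a, 'b) atensor"
  assume X: "proj_rel X X'"
  then have "(\<lambda>n. norm c * proj_norm (X n - X' n)) \<longlonglongrightarrow> norm c * 0"
    unfolding proj_rel_def by (intro tendsto_mult tendsto_const) simp
  then show "proj_rel (\<lambda>n. c *\<^sub>C X n) (\<lambda>n. c *\<^sub>C X' n)"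
    using X by (simp add: proj_rel_def proj_Cauchy_scaleC proj_norm_scaleC flip: scaleC_diff_right)
qed

lift_definition norm_ptensor :: "('a, 'b) ptensor \<Rightarrow> real" is "\<lambda>X. lim (\<lambda>n. proj_norm (X n))"
proof -
  fix X X' :: "nat \<Rightarrow> ('a, 'b) atensor"
  assume X: "proj_rel X X'"
  then obtain L where L: "(\<lambda>n. proj_norm (X' n)) \<longlonglongrightarrow> L"
    using proj_Cauchy_norm by (auto simp: proj_rel_def convergent_def)
  have "(\<lambda>n. proj_norm (X n) - proj_norm (X' n)) \<longlonglongrightarrow> 0"
    by (rule Lim_null_comparison[of _ "\<lambda>n. proj_norm (X n - X' n)"])
      (use X in \<open>auto simp: proj_rel_def intro!: always_eventually proj_norm_diff_le\<close>)
  from tendsto_add[OF this L] have "(\<lambda>n. proj_norm (X n)) \<longlonglongrightarrow> L" by simp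
  with L show "lim (\<lambda>n. proj_norm (X n)) = lim (\<lambda>n. proj_norm (X' n))" by (simp add: limI)
qed

definition uminus_ptensor :: "('a, 'b) ptensor \<Rightarrow> ('a, 'b) ptensor"
  where "uminus_ptensor u = (- 1) *\<^sub>C u"

definition minus_ptensor :: "('a, 'b) ptensor \<Rightarrow> ('a, 'b) ptensor \<Rightarrow> ('a, 'b) ptensor"
  where "minus_ptensor u v = u + - v"

definition scaleR_ptensor :: "real \<Rightarrow> ('a, 'b) ptensor \<Rightarrow> ('a, 'b) ptensor"
  where "scaleR_ptensor r u = complex_of_real r *\<^sub>C u"

definition dist_ptensor :: "('a, 'b) ptensor \<Rightarrow> ('a, 'b) ptensor \<Rightarrow> real"
  where "dist_ptensor u v = norm (u - v)"

definition sgn_ptensor :: "('a, 'b) ptensor \<Rightarrow> ('a, 'b) ptensor"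
  where "sgn_ptensor u = scaleR (inverse (norm u)) u"

definition uniformity_ptensor :: "(('a, 'b) ptensor \<times> ('a, 'b) ptensor) filter"
  where "uniformity_ptensor = (INF e\<in>{0 <..}. principal {(x, y). dist x y < e})"

definition open_ptensor :: "('a, 'b) ptensor set \<Rightarrow> bool"
  where "open_ptensor U \<longleftrightarrow> (\<forall>x\<in>U. \<forall>\<^sub>F (x', y) in uniformity. x' = x \<longrightarrow> y \<in> U)"

lemma proj_rel_refl: "proj_Cauchy X \<Longrightarrow> proj_rel X X"
  by (simp add: proj_rel_def)

lemma proj_rel_norm: "proj_rel X X \<Longrightarrow> (\<lambda>n. proj_norm (X n)) \<longlonglongrightarrow> lim (\<lambda>n. proj_norm (X n))"
  by (simp add: proj_rel_def proj_Cauchy_norm flip: convergent_LIMSEQ_iff)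

instance
proof
  fix u v w :: "('a, 'b) ptensor" and c d :: complex and r s :: real
  have add_rel: "proj_rel (\<lambda>n. X n + Y n) (\<lambda>n. X n + Y n)" if "proj_rel X X" "proj_rel Y Y"
    for X Y :: "nat \<Rightarrow> ('a, 'b) atensor"
    using that by (simp add: proj_rel_def proj_Cauchy_add)
  have scaleC_rel: "proj_rel (\<lambda>n. c *\<^sub>C X n) (\<lambda>n. c *\<^sub>C X n)" if "proj_rel X X"
    for X :: "nat \<Rightarrow> ('a, 'b) atensor" and c
    using that by (simp add: proj_rel_def proj_Cauchy_scaleC)
  show "u + v + w = u + (v + w)" by transfer (simp add: add_rel add.assoc)
  show "u + v = v + u" by transfer (simp add: add_rel add.commute)
  show "0 + u = u" by transfer simp
  show add_right: "c *\<^sub>C (u + v) = c *\<^sub>C u + c *\<^sub>C v" for c and u v :: "('a, 'b) ptensor"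
    by transfer (simp add: scaleC_add_right add_rel scaleC_rel)
  show add_left: "(c + d) *\<^sub>C u = c *\<^sub>C u + d *\<^sub>C u" for c d and u :: "('a, 'b) ptensor"
    by transfer (simp add: scaleC_add_left add_rel scaleC_rel)
  show scaleC: "c *\<^sub>C d *\<^sub>C u = (c * d) *\<^sub>C u" for c d and u :: "('a, 'b) ptensor"
    by transfer (simp add: scaleC_scaleC scaleC_rel)
  have one: "1 *\<^sub>C u = u" for u :: "('a, 'b) ptensor"
    by transfer simp
  have "0 *\<^sub>C u = 0"
    by transfer (simp add: proj_rel_def proj_Cauchy_const)
  then show "- u + u = 0"
    using add_left[of "- 1" 1 u] by (simp add: uminus_ptensor_def one)
  show "u - v = u + - v" by (rule minus_ptensor_def)
  show "r *\<^sub>R u = complex_of_real r *\<^sub>C u" by (rule scaleR_ptensor_def)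
  show "r *\<^sub>R (u + v) = r *\<^sub>R u + r *\<^sub>R v" by (simp add: scaleR_ptensor_def add_right)
  show "(r + s) *\<^sub>R u = r *\<^sub>R u + s *\<^sub>R u" by (simp add: scaleR_ptensor_def add_left)
  show "r *\<^sub>R s *\<^sub>R u = (r * s) *\<^sub>R u" by (simp add: scaleR_ptensor_def scaleC)
  show "1 *\<^sub>R u = u" by (simp add: scaleR_ptensor_def one)
  show "dist u v = norm (u - v)" by (rule dist_ptensor_def)
  show "sgn u = scaleR (inverse (norm u)) u" by (rule sgn_ptensor_def)
  show "(uniformity :: (('a, 'b) ptensor \<times> ('a, 'b) ptensor) filter) = (INF e\<in>{0 <..}. principal {(x, y). dist x y < e})"
    by (rule uniformity_ptensor_def)
  show "open U \<longleftrightarrow> (\<forall>x\<in>U. \<forall>\<^sub>F (x', y) in uniformity. x' = x \<longrightarrow> y \<in> U)" for U :: "('a, 'b) ptensor set"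
    by (rule open_ptensor_def)
  show "(norm u = 0) = (u = 0)"
  proof transfer
    fix X :: "nat \<Rightarrow> ('a, 'b) atensor"
    assume X: "proj_rel X X"
    show "(lim (\<lambda>n. proj_norm (X n)) = 0) = proj_rel X (\<lambda>_. 0)"
    proof
      assume "lim (\<lambda>n. proj_norm (X n)) = 0"
      then show "proj_rel X (\<lambda>_. 0)"
        using X proj_rel_norm[OF X] by (simp add: proj_rel_def proj_Cauchy_const)
    next
      assume "proj_rel X (\<lambda>_. 0)"
      then show "lim (\<lambda>n. proj_norm (X n)) = 0" by (simp add: proj_rel_def limI)
    qed
  qed
  show "norm (u + v) \<le> norm u + norm v"
  proof transfer
    fix X Y :: "nat \<Rightarrow> ('a, 'b) atensor"
    assume X: "proj_rel X X" and Y: "proj_rel Y Y"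
    show "lim (\<lambda>n. proj_norm (X n + Y n)) \<le> lim (\<lambda>n. proj_norm (X n)) + lim (\<lambda>n. proj_norm (Y n))"
      by (rule LIMSEQ_le[OF proj_rel_norm[OF add_rel[OF X Y]] tendsto_add[OF proj_rel_norm[OF X] proj_rel_norm[OF Y]]])
        (auto intro: proj_norm_triangle)
  qed
  show n: "norm (c *\<^sub>C u) = norm c * norm u" for c
  proof transfer
    fix c :: complex and X :: "nat \<Rightarrow> ('a, 'b) atensor"
    assume X: "proj_rel X X"
    show "lim (\<lambda>n. proj_norm (c *\<^sub>C X n)) = norm c * lim (\<lambda>n. proj_norm (X n))"
      by (rule limI) (simp add: proj_norm_scaleC tendsto_mult_left proj_rel_norm[OF X])
  qed
  show "norm (r *\<^sub>R u) = \<bar>r\<bar> * norm u" by (simp add: scaleR_ptensor_def n)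
qed

end

definition ptensor_of :: "('a::complex_normed_vector, 'b::complex_normed_vector) atensor \<Rightarrow> ('a, 'b) ptensor"
  where "ptensor_of u = abs_ptensor (\<lambda>_. u)"

lemma ptensor_of_add: "ptensor_of (u + v) = ptensor_of u + ptensor_of v"
  by (simp add: ptensor_of_def plus_ptensor.abs_eq proj_rel_refl proj_Cauchy_const)

lemma ptensor_of_scaleC: "ptensor_of (c *\<^sub>C u) = c *\<^sub>C ptensor_of u"
  by (simp add: ptensor_of_def scaleC_ptensor.abs_eq proj_rel_refl proj_Cauchy_const)

lemma ptensor_of_zero: "ptensor_of 0 = 0"
  by (simp add: ptensor_of_def zero_ptensor_def)

lemma ptensor_of_diff: "ptensor_of (u - v) = ptensor_of u - ptensor_of v"
  by (simp add: minus_atensor_def minus_ptensor_def uminus_atensor_def uminus_ptensor_def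
      ptensor_of_add ptensor_of_scaleC)

lemma norm_ptensor_of: "norm (ptensor_of u) = proj_norm u"
  by (simp add: ptensor_of_def norm_ptensor.abs_eq proj_rel_refl proj_Cauchy_const)

lemma ptensor_of_tendsto:
  assumes X: "proj_Cauchy X"
  shows "(\<lambda>n. ptensor_of (X n)) \<longlonglongrightarrow> abs_ptensor X"
proof (rule LIMSEQ_I)
  fix e :: real assume "e > 0"
  then obtain N where N: "\<And>m n. m \<ge> N \<Longrightarrow> n \<ge> N \<Longrightarrow> proj_norm (X m - X n) < e / 2"
    using X unfolding proj_Cauchy_def by (metis half_gt_zero)
  have "norm (ptensor_of (X m) - abs_ptensor X) < e" if m: "m \<ge> N" for m
  proof -
    have "ptensor_of (X m) - abs_ptensor X = abs_ptensor (\<lambda>n. X m + (- 1) *\<^sub>C X n)"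
      using X by (simp add: minus_ptensor_def uminus_ptensor_def ptensor_of_def plus_ptensor.abs_eq
          scaleC_ptensor.abs_eq proj_rel_refl proj_Cauchy_const proj_Cauchy_scaleC)
    then have eq: "ptensor_of (X m) - abs_ptensor X = abs_ptensor (\<lambda>n. X m - X n)"
      by (simp add: minus_atensor_def uminus_atensor_def)
    have C: "proj_Cauchy (\<lambda>n. X m - X n)"
      using proj_Cauchy_add[OF proj_Cauchy_const[of "X m"] proj_Cauchy_scaleC[OF X, of "- 1"]]
      by (simp add: minus_atensor_def uminus_atensor_def)
    then have "(\<lambda>n. proj_norm (X m - X n)) \<longlonglongrightarrow> norm (ptensor_of (X m) - abs_ptensor X)"
      unfolding eq using proj_rel_norm[of "\<lambda>n. X m - X n"]
      by (simp add: norm_ptensor.abs_eq proj_rel_refl)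
    then have "norm (ptensor_of (X m) - abs_ptensor X) \<le> e / 2"
      by (rule LIMSEQ_le_const2) (use N m less_imp_le in blast)
    then show ?thesis using \<open>e > 0\<close> by simp
  qed
  then show "\<exists>N. \<forall>n\<ge>N. norm (ptensor_of (X n) - abs_ptensor X) < e" by blast
qed

lemma ptensor_cases:
  obtains X where "proj_Cauchy X" "u = abs_ptensor X"
  by (induction u rule: ptensor.abs_induct) (auto simp: proj_rel_def)

lemma ptensor_of_dense:
  assumes "e > 0"
  shows "\<exists>v. norm (u - ptensor_of v) < e"
proof -
  obtain X where X: "proj_Cauchy X" "u = abs_ptensor X" by (rule ptensor_cases)
  then obtain n where "norm (ptensor_of (X n) - u) < e"
    using LIMSEQ_D[OF ptensor_of_tendsto[OF X(1)] assms] by blast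
  then show ?thesis by (metis norm_minus_commute)
qed

instance ptensor :: (complex_normed_vector, complex_normed_vector) complex_banach
proof
  fix U :: "nat \<Rightarrow> ('a, 'b) ptensor"
  assume U: "Cauchy U"
  have "\<forall>n. \<exists>v. norm (U n - ptensor_of v) < inverse (real (Suc n))"
    by (intro allI ptensor_of_dense) simp
  then obtain v where v: "\<And>n. norm (U n - ptensor_of (v n)) < inverse (real (Suc n))"
    by metis
  have d: "(\<lambda>n. U n - ptensor_of (v n)) \<longlonglongrightarrow> 0"
    by (rule Lim_null_comparison[OF always_eventually LIMSEQ_inverse_real_of_nat])
      (use v less_imp_le in blast)
  have "Cauchy (\<lambda>n. ptensor_of (v n))"
  proof (rule CauchyI)
    fix e :: real assume "e > 0"
    then obtain M N where M: "\<And>m n. m \<ge> M \<Longrightarrow> n \<ge> M \<Longrightarrow> norm (U m - U n) < e / 3"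
      and N: "\<And>n. n \<ge> N \<Longrightarrow> norm (U n - ptensor_of (v n)) < e / 3"
      using CauchyD[OF U, of "e / 3"] LIMSEQ_D[OF d, of "e / 3"] by auto
    have "norm (ptensor_of (v m) - ptensor_of (v n)) < e" if "m \<ge> max M N" "n \<ge> max M N" for m n
    proof -
      have "ptensor_of (v m) - ptensor_of (v n) =
          (U m - U n) - (U m - ptensor_of (v m)) + (U n - ptensor_of (v n))" by simp
      also have "norm \<dots> \<le> norm (U m - U n) + norm (U m - ptensor_of (v m)) + norm (U n - ptensor_of (v n))"
        by (meson norm_triangle_ineq norm_triangle_ineq4 add_right_mono order_trans)
      finally show ?thesis using M[of m n] N[of m] N[of n] that by simp
    qed
    then show "\<exists>M. \<forall>m\<ge>M. \<forall>n\<ge>M. norm (ptensor_of (v m) - ptensor_of (v n)) < e" by blast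
  qed
  then have "proj_Cauchy v"
    by (simp add: Cauchy_iff proj_Cauchy_def norm_ptensor_of flip: ptensor_of_diff)
  from tendsto_add[OF d ptensor_of_tendsto[OF this]]
  show "convergent U" by (auto simp: convergent_def)
qed

definition tensor :: "'a::complex_normed_vector \<Rightarrow> 'b::complex_normed_vector \<Rightarrow> ('a, 'b) ptensor"
    (infixl \<open>\<otimes>\<^sub>p\<close> 70)
  where "a \<otimes>\<^sub>p b = ptensor_of (atensor a b)"

lemma atensor_add_left: "atensor (a + a') b = atensor a b + atensor a' b"
  by transfer (simp add: tensor_eq.add_left)

lemma atensor_add_right: "atensor a (b + b') = atensor a b + atensor a b'"
  by transfer (simp add: tensor_eq.add_right)

lemma atensor_scaleC_left: "atensor (c *\<^sub>C a) b = c *\<^sub>C atensor a b"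
  by transfer (simp add: tensor_eq.refl)

lemma atensor_scaleC_right: "atensor a (c *\<^sub>C b) = c *\<^sub>C atensor a b"
  by transfer (simp add: tensor_eq.scaleC tensor_eq.sym)

lemma bounded_cbilinear_tensor:
  "bounded_cbilinear ((\<otimes>\<^sub>p) :: 'a::complex_normed_vector \<Rightarrow> 'b::complex_normed_vector \<Rightarrow> _)"
proof -
  have scale: "(c *\<^sub>C a) \<otimes>\<^sub>p b = c *\<^sub>C (a \<otimes>\<^sub>p b)" "a \<otimes>\<^sub>p (c *\<^sub>C b) = c *\<^sub>C (a \<otimes>\<^sub>p b)"
    for c and a :: 'a and b :: 'b
    by (simp_all add: tensor_def atensor_scaleC_left atensor_scaleC_right ptensor_of_scaleC)
  have "bounded_bilinear ((\<otimes>\<^sub>p) :: 'a \<Rightarrow> 'b \<Rightarrow> _)"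
  proof
    show "\<exists>K. \<forall>(a::'a) (b::'b). norm (a \<otimes>\<^sub>p b) \<le> norm a * norm b * K"
      by (rule exI[of _ 1]) (simp add: tensor_def norm_ptensor_of proj_norm_atensor_le)
  qed (simp_all add: scale scaleR_scaleC, simp_all add: tensor_def atensor_add_left atensor_add_right ptensor_of_add)
  then show ?thesis by (simp add: bounded_cbilinear_def scale)
qed

lemma ptensor_of_sum: "ptensor_of (\<Sum>(a, b)\<leftarrow>xs. atensor a b) = (\<Sum>(a, b)\<leftarrow>xs. a \<otimes>\<^sub>p b)"
  by (induction xs) (auto simp: ptensor_of_zero ptensor_of_add tensor_def)

lemma norm_tensor_sum:
  "norm (\<Sum>(a, b)\<leftarrow>xs. a \<otimes>\<^sub>p b) =
    Inf {(\<Sum>(a, b)\<leftarrow>ys. norm a * norm b) | ys. (\<Sum>(a, b)\<leftarrow>xs. atensor a b) = (\<Sum>(a, b)\<leftarrow>ys. atensor a b)}"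
  by (simp add: norm_ptensor_of proj_norm_def flip: ptensor_of_sum)

lemma tensor_sums_dense: "e > 0 \<Longrightarrow> \<exists>xs. norm (u - (\<Sum>(a, b)\<leftarrow>xs. a \<otimes>\<^sub>p b)) < e"
  using ptensor_of_dense[of e u] atensor_sum_ex by (metis ptensor_of_sum)

text \<open>The bounded linear map \<open>T\<close> on the projective tensor product determined by
  \<open>T (a \<otimes>\<^sub>p b) = \<beta> a b\<close>, for a bounded bilinear map \<open>\<beta>\<close> into a Banach space.\<close>

definition tensor_lift ::
    "('a::complex_normed_vector \<Rightarrow> 'b::complex_normed_vector \<Rightarrow> 'c::complex_banach) \<Rightarrow> ('a, 'b) ptensor \<Rightarrow> 'c"
  where "tensor_lift \<beta> = (THE T. bounded_clinear T \<and> (\<forall>a b. T (a \<otimes>\<^sub>p b) = \<beta> a b))"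

lemma tensor_eq_sum:
  assumes "bounded_cbilinear \<beta>" "tensor_eq xs ys"
  shows "(\<Sum>(a, b)\<leftarrow>xs. \<beta> a b) = (\<Sum>(a, b)\<leftarrow>ys. \<beta> a b)"
proof -
  interpret bounded_bilinear \<beta> using assms(1) by (simp add: bounded_cbilinear_def)
  show ?thesis using assms(2)
    by induction (use assms(1) in \<open>auto simp: zero_left add_left add_right bounded_cbilinear_def\<close>)
qed

lemma bounded_clinear_ptensor_eqI:
  fixes S T :: "('a::complex_normed_vector, 'b::complex_normed_vector) ptensor \<Rightarrow> 'c::complex_normed_vector"
  assumes S: "bounded_clinear S" and T: "bounded_clinear T"
    and eq: "\<And>a b. S (a \<otimes>\<^sub>p b) = T (a \<otimes>\<^sub>p b)"
  shows "S = T"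
proof
  fix u :: "('a, 'b) ptensor"
  note S = bounded_clinear_linear[OF S] and T = bounded_clinear_linear[OF T]
  obtain X where X: "proj_Cauchy X" "u = abs_ptensor X" by (rule ptensor_cases)
  have sum: "R (\<Sum>(a, b)\<leftarrow>xs. a \<otimes>\<^sub>p b) = (\<Sum>(a, b)\<leftarrow>xs. R (a \<otimes>\<^sub>p b))" if "bounded_linear R" for R :: "('a, 'b) ptensor \<Rightarrow> 'c" and xs
    by (induction xs) (auto simp: bounded_linear.linear[OF that] linear_add linear_0)
  have "S (ptensor_of v) = T (ptensor_of v)" for v
  proof -
    obtain xs where "v = (\<Sum>(a, b)\<leftarrow>xs. atensor a b)" using atensor_sum_ex by blast
    then show ?thesis by (simp add: ptensor_of_sum sum[OF S] sum[OF T] eq)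
  qed
  moreover have "(\<lambda>n. S (ptensor_of (X n))) \<longlonglongrightarrow> S u" "(\<lambda>n. T (ptensor_of (X n))) \<longlonglongrightarrow> T u"
    unfolding X(2) by (intro bounded_linear.tendsto[OF S] bounded_linear.tendsto[OF T] ptensor_of_tendsto X(1))+
  ultimately show "S u = T u" by (simp add: LIMSEQ_unique)
qed

lemma tensor_lift_ex:
  fixes \<beta> :: "'a::complex_normed_vector \<Rightarrow> 'b::complex_normed_vector \<Rightarrow> 'c::complex_banach"
  assumes \<beta>: "bounded_cbilinear \<beta>"
    and K: "K \<ge> 0" "\<And>a b. norm (\<beta> a b) \<le> K * (norm a * norm b)"
  shows "\<exists>T. bounded_clinear T \<and> (\<forall>a b. T (a \<otimes>\<^sub>p b) = \<beta> a b) \<and> (\<forall>u. norm (T u) \<le> K * norm u)"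
proof -
  interpret bounded_bilinear \<beta> using \<beta> by (simp add: bounded_cbilinear_def)
  define S where "S u = (\<Sum>(a, b)\<leftarrow>rep_atensor u. \<beta> a b)" for u
  have S_abs: "S (abs_atensor xs) = (\<Sum>(a, b)\<leftarrow>xs. \<beta> a b)" for xs
    unfolding S_def by (rule tensor_eq_sum[OF \<beta>])
      (rule Quotient_rep_abs[OF Quotient_atensor tensor_eq.refl])
  have S_add: "S (u + v) = S u + S v" for u v
    by (induction u rule: atensor.abs_induct, induction v rule: atensor.abs_induct)
      (simp add: plus_atensor.abs_eq S_abs)
  have scale_sum: "(\<Sum>(a, b)\<leftarrow>map (\<lambda>(a, b). (c *\<^sub>C a, b)) xs. \<beta> a b) = c *\<^sub>C (\<Sum>(a, b)\<leftarrow>xs. \<beta> a b)" for c xs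
    by (induction xs) (use \<beta> in \<open>auto simp: scaleC_add_right bounded_cbilinear_def\<close>)
  have S_scaleC: "S (c *\<^sub>C u) = c *\<^sub>C S u" for c u
    by (induction u rule: atensor.abs_induct) (simp only: scaleC_atensor.abs_eq S_abs scale_sum)
  have S_diff: "S (u - v) = S u - S v" for u v
    using S_add[of u "- v"] S_scaleC[of "- 1" v] scaleC_minus_left[of 1 "S v"]
    by (simp flip: uminus_atensor_def)
  have sum_le: "norm (\<Sum>(a, b)\<leftarrow>xs. \<beta> a b) \<le> K * list_norm xs" for xs
  proof (induction xs)
    case (Cons x xs)
    obtain a b where x: "x = (a, b)" by (cases x)
    show ?case
      using norm_triangle_ineq[of "\<beta> a b" "\<Sum>(a, b)\<leftarrow>xs. \<beta> a b"] K(2)[of a b] Cons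
      by (simp add: x list_norm_def algebra_simps)
  qed (simp add: list_norm_def)
  have S_bound: "norm (S u) \<le> K * proj_norm u" for u
  proof (rule field_le_epsilon)
    fix e :: real assume "e > 0"
    then have "e / (K + 1) > 0" using K(1) by simp
    then obtain xs where u: "u = (\<Sum>(a, b)\<leftarrow>xs. atensor a b)" and xs: "list_norm xs < proj_norm u + e / (K + 1)"
      by (rule proj_norm_approx)
    have "norm (S u) \<le> K * list_norm xs"
      unfolding u sum_list_atensor S_abs by (rule sum_le)
    also have "\<dots> \<le> K * (proj_norm u + e / (K + 1))"
      using xs K(1) by (intro mult_left_mono) auto
    also have "\<dots> \<le> K * proj_norm u + e"
      using K(1) \<open>e > 0\<close> by (simp add: field_simps)
    finally show "norm (S u) \<le> K * proj_norm u + e" .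
  qed
  define T where "T u = lim (\<lambda>n. S (rep_ptensor u n))" for u
  have S_conv: "convergent (\<lambda>n. S (X n))" if X: "proj_Cauchy X" for X
  proof -
    have "Cauchy (\<lambda>n. S (X n))"
    proof (rule CauchyI)
      fix e :: real assume "e > 0"
      then have "e / (K + 1) > 0" using K(1) by simp
      then obtain N where N: "\<And>m n. m \<ge> N \<Longrightarrow> n \<ge> N \<Longrightarrow> proj_norm (X m - X n) < e / (K + 1)"
        using X unfolding proj_Cauchy_def by blast
      have "norm (S (X m) - S (X n)) < e" if "m \<ge> N" "n \<ge> N" for m n
      proof -
        have "norm (S (X m) - S (X n)) \<le> K * proj_norm (X m - X n)"
          using S_bound[of "X m - X n"] by (simp add: S_diff)
        also have "\<dots> \<le> (K + 1) * proj_norm (X m - X n)"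
          by (simp add: algebra_simps proj_norm_nonneg)
        also have "\<dots> < (K + 1) * (e / (K + 1))"
          using N[OF that] K(1) by (intro mult_strict_left_mono) auto
        also have "\<dots> = e" using K(1) by simp
        finally show ?thesis .
      qed
      then show "\<exists>M. \<forall>m\<ge>M. \<forall>n\<ge>M. norm (S (X m) - S (X n)) < e" by blast
    qed
    then show ?thesis by (simp add: Cauchy_convergent_iff)
  qed
  have T_abs: "(\<lambda>n. S (X n)) \<longlonglongrightarrow> T (abs_ptensor X)" if X: "proj_Cauchy X" for X
  proof -
    let ?Y = "rep_ptensor (abs_ptensor X)"
    have r: "proj_rel X ?Y"
      by (rule Quotient_rel[OF Quotient_ptensor, THEN iffD1])
        (intro conjI proj_rel_refl X Quotient_rep_reflp[OF Quotient_ptensor]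
          Quotient_abs_rep[OF Quotient_ptensor, symmetric])
    have "(\<lambda>n. S (X n) - S (?Y n)) \<longlonglongrightarrow> 0"
    proof (rule Lim_null_comparison[OF always_eventually])
      show "\<forall>n. norm (S (X n) - S (?Y n)) \<le> K * proj_norm (X n - ?Y n)"
        using S_bound by (simp flip: S_diff)
      show "(\<lambda>n. K * proj_norm (X n - ?Y n)) \<longlonglongrightarrow> 0"
        using r unfolding proj_rel_def by (intro tendsto_mult_right_zero) simp
    qed
    moreover have "(\<lambda>n. S (?Y n)) \<longlonglongrightarrow> T (abs_ptensor X)"
      using S_conv[of ?Y] r by (simp add: T_def proj_rel_def convergent_LIMSEQ_iff)
    ultimately have "(\<lambda>n. (S (X n) - S (?Y n)) + S (?Y n)) \<longlonglongrightarrow> 0 + T (abs_ptensor X)"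
      by (rule tendsto_add)
    then show ?thesis by simp
  qed
  have T_of: "T (ptensor_of u) = S u" for u
    using T_abs[OF proj_Cauchy_const, of u] by (simp add: ptensor_of_def LIMSEQ_const_iff)
  have T_add: "T (u + v) = T u + T v" for u v
  proof -
    obtain X Y where X: "proj_Cauchy X" "u = abs_ptensor X" and Y: "proj_Cauchy Y" "v = abs_ptensor Y"
      using ptensor_cases[of u] ptensor_cases[of v] by metis
    then have "u + v = abs_ptensor (\<lambda>n. X n + Y n)"
      by (simp add: plus_ptensor.abs_eq proj_rel_refl)
    then have "(\<lambda>n. S (X n) + S (Y n)) \<longlonglongrightarrow> T (u + v)"
      using T_abs[OF proj_Cauchy_add[OF X(1) Y(1)]] by (simp add: S_add)
    moreover have "(\<lambda>n. S (X n) + S (Y n)) \<longlonglongrightarrow> T u + T v"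
      unfolding X(2) Y(2) by (intro tendsto_add T_abs X Y)
    ultimately show ?thesis by (rule LIMSEQ_unique)
  qed
  have T_bound: "norm (T u) \<le> K * norm u" for u
  proof -
    obtain X where X: "proj_Cauchy X" "u = abs_ptensor X" by (rule ptensor_cases)
    have "(\<lambda>n. norm (S (X n))) \<longlonglongrightarrow> norm (T u)"
      unfolding X(2) by (intro tendsto_norm T_abs X(1))
    moreover have "(\<lambda>n. K * norm (ptensor_of (X n))) \<longlonglongrightarrow> K * norm u"
      unfolding X(2) by (intro tendsto_mult_left tendsto_norm ptensor_of_tendsto X(1))
    ultimately show ?thesis
      by (rule LIMSEQ_le) (simp add: norm_ptensor_of S_bound)
  qed
  have T_scaleC: "T (c *\<^sub>C u) = c *\<^sub>C T u" for c u
  proof -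
    obtain X where X: "proj_Cauchy X" "u = abs_ptensor X" by (rule ptensor_cases)
    have "c *\<^sub>C u = abs_ptensor (\<lambda>n. c *\<^sub>C X n)"
      using X by (simp add: scaleC_ptensor.abs_eq proj_rel_refl)
    then have 1: "(\<lambda>n. c *\<^sub>C S (X n)) \<longlonglongrightarrow> T (c *\<^sub>C u)"
      using T_abs[OF proj_Cauchy_scaleC[OF X(1)], of c] by (simp add: S_scaleC)
    have "bounded_linear (\<lambda>x::'c. c *\<^sub>C x)"
      by (rule bounded_linear_intro[of _ "norm c"])
        (auto simp: scaleC_add_right scaleR_scaleC scaleC_scaleC mult.commute norm_scaleC)
    from bounded_linear.tendsto[OF this T_abs[OF X(1)]]
    have "(\<lambda>n. c *\<^sub>C S (X n)) \<longlonglongrightarrow> c *\<^sub>C T u" by (simp add: X(2))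
    with 1 show ?thesis by (rule LIMSEQ_unique)
  qed
  have "bounded_clinear T"
    by (rule bounded_clinearI[OF T_add T_scaleC, of K]) (use T_bound in \<open>simp add: mult.commute\<close>)
  moreover have "T (a \<otimes>\<^sub>p b) = \<beta> a b" for a b
    by (simp add: tensor_def T_of atensor.abs_eq S_abs)
  ultimately show ?thesis using T_bound by blast
qed

lemma
  assumes \<beta>: "bounded_cbilinear \<beta>"
  shows bounded_clinear_tensor_lift: "bounded_clinear (tensor_lift \<beta>)"
    and tensor_lift_tensor: "tensor_lift \<beta> (a \<otimes>\<^sub>p b) = \<beta> a b"
proof -
  obtain K where K: "K \<ge> 0" "\<And>a b. norm (\<beta> a b) \<le> norm a * norm b * K"
    using bounded_bilinear.nonneg_bounded[of \<beta>] \<beta> unfolding bounded_cbilinear_def by blast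
  obtain T where T: "bounded_clinear T \<and> (\<forall>a b. T (a \<otimes>\<^sub>p b) = \<beta> a b)"
    using tensor_lift_ex[OF \<beta> K(1)] K(2) by (auto simp: mult.commute)
  then have "tensor_lift \<beta> = T"
    unfolding tensor_lift_def
    by (intro the_equality) (auto intro!: bounded_clinear_ptensor_eqI)
  with T show "bounded_clinear (tensor_lift \<beta>)" "tensor_lift \<beta> (a \<otimes>\<^sub>p b) = \<beta> a b" by auto
qed

section \<open>The semigroup algebra\<close>

typedef 's l1 = "{f :: 's \<Rightarrow> complex. (\<lambda>s. norm (f s)) summable_on UNIV}"
  morphisms l1_apply Abs_l1
  by (rule exI[of _ "\<lambda>_. 0"]) simp

setup_lifting type_definition_l1

lemma l1_abs_summable: "(\<lambda>s. norm (l1_apply f s)) summable_on UNIV"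
  using l1_apply[of f] by simp

lemma l1_eqI: "(\<And>s. l1_apply f s = l1_apply g s) \<Longrightarrow> f = g"
  by (simp add: l1_apply_inject[symmetric] fun_eq_iff)

lemma abs_summable_add:
  fixes f g :: "'s \<Rightarrow> complex"
  assumes "(\<lambda>s. norm (f s)) summable_on UNIV" "(\<lambda>s. norm (g s)) summable_on UNIV"
  shows "(\<lambda>s. norm (f s + g s)) summable_on UNIV"
  by (rule summable_on_comparison_test[OF summable_on_add[OF assms]]) (auto intro: norm_triangle_ineq)

lemma abs_summable_cmult:
  fixes f :: "'s \<Rightarrow> complex"
  assumes "(\<lambda>s. norm (f s)) summable_on UNIV"
  shows "(\<lambda>s. norm (c * f s)) summable_on UNIV"
  by (simp add: norm_mult summable_on_cmult_right assms)

instantiation l1 :: (type) complex_normed_vector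
begin

lift_definition zero_l1 :: "'a l1" is "\<lambda>_. 0"
  by simp

lift_definition plus_l1 :: "'a l1 \<Rightarrow> 'a l1 \<Rightarrow> 'a l1" is "\<lambda>f g s. f s + g s"
  by (rule abs_summable_add)

lift_definition uminus_l1 :: "'a l1 \<Rightarrow> 'a l1" is "\<lambda>f s. - f s"
  by simp

definition minus_l1 :: "'a l1 \<Rightarrow> 'a l1 \<Rightarrow> 'a l1"
  where "minus_l1 f g = f + - g"

lift_definition scaleC_l1 :: "complex \<Rightarrow> 'a l1 \<Rightarrow> 'a l1" is "\<lambda>c f s. c * f s"
  by (rule abs_summable_cmult)

definition scaleR_l1 :: "real \<Rightarrow> 'a l1 \<Rightarrow> 'a l1"
  where "scaleR_l1 r f = complex_of_real r *\<^sub>C f"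

lift_definition norm_l1 :: "'a l1 \<Rightarrow> real" is "\<lambda>f. \<Sum>\<^sub>\<infinity>s. norm (f s)" .

definition dist_l1 :: "'a l1 \<Rightarrow> 'a l1 \<Rightarrow> real" where "dist_l1 f g = norm (f - g)"

definition sgn_l1 :: "'a l1 \<Rightarrow> 'a l1" where "sgn_l1 f = scaleR (inverse (norm f)) f"

definition uniformity_l1 :: "('a l1 \<times> 'a l1) filter"
  where "uniformity_l1 = (INF e\<in>{0 <..}. principal {(x, y). dist x y < e})"

definition open_l1 :: "'a l1 set \<Rightarrow> bool"
  where "open_l1 U \<longleftrightarrow> (\<forall>x\<in>U. \<forall>\<^sub>F (x', y) in uniformity. x' = x \<longrightarrow> y \<in> U)"

instance
proof
  fix f g h :: "'a l1" and c d :: complex and r s :: real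
  show "f + g + h = f + (g + h)" by transfer (simp add: algebra_simps)
  show "f + g = g + f" by transfer (simp add: algebra_simps)
  show "0 + f = f" by transfer simp
  show "- f + f = 0" by transfer simp
  show "f - g = f + - g" by (rule minus_l1_def)
  show add_right: "c *\<^sub>C (f + g) = c *\<^sub>C f + c *\<^sub>C g" for c f and g :: "'a l1"
    by transfer (simp add: algebra_simps)
  show add_left: "(c + d) *\<^sub>C f = c *\<^sub>C f + d *\<^sub>C f" for c d and f :: "'a l1"
    by transfer (simp add: algebra_simps)
  show scaleC: "c *\<^sub>C d *\<^sub>C f = (c * d) *\<^sub>C f" for c d and f :: "'a l1"
    by transfer (simp add: algebra_simps)
  show "r *\<^sub>R f = complex_of_real r *\<^sub>C f" by (rule scaleR_l1_def)
  show "r *\<^sub>R (f + g) = r *\<^sub>R f + r *\<^sub>R g" by (simp add: scaleR_l1_def add_right)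
  show "(r + s) *\<^sub>R f = r *\<^sub>R f + s *\<^sub>R f" by (simp add: scaleR_l1_def add_left)
  show "r *\<^sub>R s *\<^sub>R f = (r * s) *\<^sub>R f" by (simp add: scaleR_l1_def scaleC)
  show "1 *\<^sub>R f = f" unfolding scaleR_l1_def by transfer simp
  show "dist f g = norm (f - g)" by (rule dist_l1_def)
  show "sgn f = scaleR (inverse (norm f)) f" by (rule sgn_l1_def)
  show "(uniformity :: ('a l1 \<times> 'a l1) filter) = (INF e\<in>{0 <..}. principal {(x, y). dist x y < e})"
    by (rule uniformity_l1_def)
  show "open U \<longleftrightarrow> (\<forall>x\<in>U. \<forall>\<^sub>F (x', y) in uniformity. x' = x \<longrightarrow> y \<in> U)" for U :: "'a l1 set"
    by (rule open_l1_def)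
  show "(norm f = 0) = (f = 0)"
  proof transfer
    fix f :: "'a \<Rightarrow> complex"
    assume f: "(\<lambda>s. norm (f s)) summable_on UNIV"
    show "((\<Sum>\<^sub>\<infinity>s. norm (f s)) = 0) = (f = (\<lambda>_. 0))"
    proof
      assume eq: "(\<Sum>\<^sub>\<infinity>s. norm (f s)) = 0"
      have "norm (f s) \<le> 0" for s
        using finite_sum_le_infsum[OF f, of "{s}"] by (simp add: eq)
      then show "f = (\<lambda>_. 0)" by (simp add: fun_eq_iff)
    qed simp
  qed
  show "norm (f + g) \<le> norm f + norm g"
  proof transfer
    fix f g :: "'a \<Rightarrow> complex"
    assume f: "(\<lambda>s. norm (f s)) summable_on UNIV" and g: "(\<lambda>s. norm (g s)) summable_on UNIV"
    show "(\<Sum>\<^sub>\<infinity>s. norm (f s + g s)) \<le> (\<Sum>\<^sub>\<infinity>s. norm (f s)) + (\<Sum>\<^sub>\<infinity>s. norm (g s))"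
      unfolding infsum_add[OF f g, symmetric]
      by (intro infsum_mono abs_summable_add f g summable_on_add norm_triangle_ineq)
  qed
  show n: "norm (c *\<^sub>C f) = norm c * norm f" for c
    by transfer (simp add: norm_mult infsum_cmult_right)
  show "norm (r *\<^sub>R f) = \<bar>r\<bar> * norm f" by (simp add: scaleR_l1_def n)
qed

end

lemma l1_apply_diff: "l1_apply (f - g) s = l1_apply f s - l1_apply g s"
  by (simp add: minus_l1_def plus_l1.rep_eq uminus_l1.rep_eq del: add_uminus_conv_diff)

lemma norm_sum_l1_le: "finite F \<Longrightarrow> (\<Sum>s\<in>F. norm (l1_apply f s)) \<le> norm f"
  unfolding norm_l1.rep_eq by (intro finite_sum_le_infsum l1_abs_summable) auto

lemma norm_l1_apply_le: "norm (l1_apply f s) \<le> norm f"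
  using norm_sum_l1_le[of "{s}" f] by simp

instance l1 :: (type) complex_banach
proof
  fix X :: "nat \<Rightarrow> 'a l1"
  assume X: "Cauchy X"
  have "Cauchy (\<lambda>n. l1_apply (X n) s)" for s
  proof (rule CauchyI)
    fix e :: real assume "e > 0"
    then obtain N where N: "\<And>m n. m \<ge> N \<Longrightarrow> n \<ge> N \<Longrightarrow> norm (X m - X n) < e"
      using CauchyD[OF X] by blast
    have "norm (l1_apply (X m) s - l1_apply (X n) s) < e" if "m \<ge> N" "n \<ge> N" for m n
      using norm_l1_apply_le[of "X m - X n" s] N[OF that] by (simp add: l1_apply_diff)
    then show "\<exists>M. \<forall>m\<ge>M. \<forall>n\<ge>M. norm (l1_apply (X m) s - l1_apply (X n) s) < e" by blast
  qed
  then have "\<exists>l. (\<lambda>n. l1_apply (X n) s) \<longlonglongrightarrow> l" for s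
    by (simp add: Cauchy_convergent_iff convergent_def)
  then obtain f where f: "\<And>s. (\<lambda>n. l1_apply (X n) s) \<longlonglongrightarrow> f s" by metis
  have fin: "\<exists>N. \<forall>n\<ge>N. \<forall>F. finite F \<longrightarrow> (\<Sum>s\<in>F. norm (l1_apply (X n) s - f s)) \<le> e" if "e > 0" for e
  proof -
    obtain N where N: "\<And>m n. m \<ge> N \<Longrightarrow> n \<ge> N \<Longrightarrow> norm (X m - X n) < e"
      using CauchyD[OF X \<open>e > 0\<close>] by blast
    have "(\<Sum>s\<in>F. norm (l1_apply (X n) s - f s)) \<le> e" if n: "n \<ge> N" and F: "finite F" for n F
    proof (rule LIMSEQ_le_const2)
      show "(\<lambda>m. \<Sum>s\<in>F. norm (l1_apply (X n) s - l1_apply (X m) s)) \<longlonglongrightarrow> (\<Sum>s\<in>F. norm (l1_apply (X n) s - f s))"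
        by (intro tendsto_sum tendsto_norm tendsto_diff tendsto_const f)
      have "(\<Sum>s\<in>F. norm (l1_apply (X n) s - l1_apply (X m) s)) \<le> e" if "m \<ge> N" for m
        using norm_sum_l1_le[OF F, of "X n - X m"] N[OF n that] by (simp add: l1_apply_diff)
      then show "\<exists>M. \<forall>m\<ge>M. (\<Sum>s\<in>F. norm (l1_apply (X n) s - l1_apply (X m) s)) \<le> e" by blast
    qed
    then show ?thesis by blast
  qed
  obtain N where N: "\<And>F. finite F \<Longrightarrow> (\<Sum>s\<in>F. norm (l1_apply (X N) s - f s)) \<le> 1"
    using fin[OF zero_less_one] by blast
  have "(\<lambda>s. norm (l1_apply (X N) s - f s)) summable_on UNIV"
    by (rule nonneg_bdd_above_summable_on) (use N in \<open>auto intro: bdd_aboveI[of _ 1]\<close>)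
  then have "(\<lambda>s. norm (l1_apply (X N) s + (- 1) * (l1_apply (X N) s - f s))) summable_on UNIV"
    by (intro abs_summable_add abs_summable_cmult l1_abs_summable)
  then have f_l1: "(\<lambda>s. norm (f s)) summable_on UNIV" by simp
  then have app: "l1_apply (Abs_l1 f) = f" by (simp add: Abs_l1_inverse)
  have "X \<longlonglongrightarrow> Abs_l1 f"
  proof (rule LIMSEQ_I)
    fix e :: real assume "e > 0"
    then obtain N where N: "\<And>n F. n \<ge> N \<Longrightarrow> finite F \<Longrightarrow> (\<Sum>s\<in>F. norm (l1_apply (X n) s - f s)) \<le> e / 2"
      using fin[OF half_gt_zero[OF \<open>e > 0\<close>]] by blast
    have "norm (X n - Abs_l1 f) < e" if "n \<ge> N" for n
    proof -
      have "norm (X n - Abs_l1 f) \<le> e / 2"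
        unfolding norm_l1.rep_eq
        by (rule infsum_le_finite_sums[OF l1_abs_summable]) (use N[OF that] in \<open>simp only: l1_apply_diff app\<close>)
      then show ?thesis using \<open>e > 0\<close> by simp
    qed
    then show "\<exists>N. \<forall>n\<ge>N. norm (X n - Abs_l1 f) < e" by blast
  qed
  then show "convergent X" by (auto simp: convergent_def)
qed

lemma
  fixes h :: "'p \<Rightarrow> 'c::banach" and q :: "'p \<Rightarrow> 's"
  assumes h: "h summable_on UNIV"
  shows summable_on_fibres: "(\<lambda>s. \<Sum>\<^sub>\<infinity>p\<in>{p. q p = s}. h p) summable_on UNIV"
    and infsum_fibres: "(\<Sum>\<^sub>\<infinity>s. \<Sum>\<^sub>\<infinity>p\<in>{p. q p = s}. h p) = (\<Sum>\<^sub>\<infinity>p. h p)"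
proof -
  let ?S = "Sigma UNIV (\<lambda>s. {p. q p = s})"
  have bij: "bij_betw snd ?S UNIV"
    by (rule bij_betwI[of _ _ _ "\<lambda>p. (q p, p)"]) auto
  have s: "(\<lambda>(s, p). h p) summable_on ?S"
    using summable_on_reindex_bij_betw[OF bij, of h] h by (simp add: case_prod_unfold)
  show "(\<lambda>s. \<Sum>\<^sub>\<infinity>p\<in>{p. q p = s}. h p) summable_on UNIV"
    by (rule summable_on_Sigma_banach[OF s])
  show "(\<Sum>\<^sub>\<infinity>s. \<Sum>\<^sub>\<infinity>p\<in>{p. q p = s}. h p) = (\<Sum>\<^sub>\<infinity>p. h p)"
    using infsum_Sigma'_banach[OF s] infsum_reindex_bij_betw[OF bij, of h]
    by (simp add: case_prod_unfold)
qed

lemma abs_summable_prod: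
  fixes f :: "'s \<Rightarrow> complex" and g :: "'t \<Rightarrow> complex"
  assumes f: "(\<lambda>s. norm (f s)) summable_on UNIV" and g: "(\<lambda>t. norm (g t)) summable_on UNIV"
  shows "(\<lambda>(s, t). norm (f s * g t)) summable_on UNIV"
    and "(\<Sum>\<^sub>\<infinity>(s, t). norm (f s * g t)) = (\<Sum>\<^sub>\<infinity>s. norm (f s)) * (\<Sum>\<^sub>\<infinity>t. norm (g t))"
proof -
  have "(\<lambda>p. norm ((\<lambda>(s, t). f s * g t) p)) summable_on (SIGMA s:UNIV. UNIV)"
    unfolding Infinite_Sum.abs_summable_on_Sigma_iff
    by (auto simp: norm_mult infsum_cmult_right g abs_mult intro!: summable_on_cmult_right summable_on_cmult_left f g)
  then show s: "(\<lambda>(s, t). norm (f s * g t)) summable_on UNIV"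
    by (simp add: case_prod_unfold)
  show "(\<Sum>\<^sub>\<infinity>(s, t). norm (f s * g t)) = (\<Sum>\<^sub>\<infinity>s. norm (f s)) * (\<Sum>\<^sub>\<infinity>t. norm (g t))"
    using infsum_Sigma'_banach[of "\<lambda>s t. norm (f s * g t)" UNIV "\<lambda>_. UNIV"] s
    by (simp add: norm_mult infsum_cmult_right g infsum_cmult_left f)
qed

lemma
  fixes f g :: "'s::semigroup_mult \<Rightarrow> complex"
  assumes f: "(\<lambda>s. norm (f s)) summable_on UNIV" and g: "(\<lambda>s. norm (g s)) summable_on UNIV"
  shows conv_abs_summable: "(\<lambda>s. norm (\<Sum>\<^sub>\<infinity>(t, u)\<in>{(t, u). t * u = s}. f t * g u)) summable_on UNIV"
    and conv_norm_le: "(\<Sum>\<^sub>\<infinity>s. norm (\<Sum>\<^sub>\<infinity>(t, u)\<in>{(t, u). t * u = s}. f t * g u))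
      \<le> (\<Sum>\<^sub>\<infinity>s. norm (f s)) * (\<Sum>\<^sub>\<infinity>s. norm (g s))"
proof -
  let ?h = "\<lambda>p. norm ((\<lambda>(t, u). f t * g u) p)"
  let ?q = "\<lambda>(t, u). t * u :: 's"
  have fib: "{(t, u). t * u = s} = {p. ?q p = s}" for s by auto
  have h: "?h summable_on UNIV"
    using abs_summable_prod(1)[OF f g] by (simp add: case_prod_unfold)
  have le: "norm (\<Sum>\<^sub>\<infinity>(t, u)\<in>{(t, u). t * u = s}. f t * g u) \<le> (\<Sum>\<^sub>\<infinity>p\<in>{p. ?q p = s}. ?h p)" for s
    unfolding fib by (rule norm_infsum_bound) (rule summable_on_subset_banach[OF h subset_UNIV])
  show s: "(\<lambda>s. norm (\<Sum>\<^sub>\<infinity>(t, u)\<in>{(t, u). t * u = s}. f t * g u)) summable_on UNIV"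
    by (rule summable_on_comparison_test[OF summable_on_fibres[OF h, of ?q]]) (use le in auto)
  have "(\<Sum>\<^sub>\<infinity>s. norm (\<Sum>\<^sub>\<infinity>(t, u)\<in>{(t, u). t * u = s}. f t * g u)) \<le> (\<Sum>\<^sub>\<infinity>p. ?h p)"
    unfolding infsum_fibres[OF h, of ?q, symmetric]
    by (rule infsum_mono[OF s summable_on_fibres[OF h]]) (rule le)
  then show "(\<Sum>\<^sub>\<infinity>s. norm (\<Sum>\<^sub>\<infinity>(t, u)\<in>{(t, u). t * u = s}. f t * g u))
      \<le> (\<Sum>\<^sub>\<infinity>s. norm (f s)) * (\<Sum>\<^sub>\<infinity>s. norm (g s))"
    using abs_summable_prod(2)[OF f g] by (simp add: case_prod_unfold)
qed

instantiation l1 :: (semigroup_mult) times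
begin

lift_definition times_l1 :: "'a l1 \<Rightarrow> 'a l1 \<Rightarrow> 'a l1"
  is "\<lambda>f g s. \<Sum>\<^sub>\<infinity>(t, u)\<in>{(t, u). t * u = s}. f t * g u"
  by (rule conv_abs_summable)

instance ..

end

lemma l1_mult_abs_summable: "(\<lambda>(t, u). norm (l1_apply f t * l1_apply g u)) summable_on UNIV"
  by (rule abs_summable_prod; rule l1_abs_summable)

lemma l1_mult_summable: "(\<lambda>(t, u). l1_apply f t * l1_apply g u) summable_on A"
proof -
  have "(\<lambda>(t, u). l1_apply f t * l1_apply g u) summable_on UNIV"
    by (rule abs_summable_summable) (use l1_mult_abs_summable in \<open>simp add: case_prod_unfold\<close>)
  then show ?thesis by (rule summable_on_subset_banach) simp
qed

lemma of_bool_mult_summable: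
  fixes h :: "'p \<Rightarrow> complex"
  assumes "(\<lambda>p. norm (h p)) summable_on UNIV"
  shows "(\<lambda>p. h p * of_bool (P p)) summable_on UNIV"
  by (rule abs_summable_summable, rule summable_on_comparison_test[OF assms]) auto

lemma times_l1_of_bool:
  "l1_apply (f * g) s = (\<Sum>\<^sub>\<infinity>(t, u). l1_apply f t * l1_apply g u * of_bool (t * u = s))"
  unfolding times_l1.rep_eq by (rule infsum_cong_neutral) auto

lemma times_l1_pairing:
  "(\<Sum>\<^sub>\<infinity>s. l1_apply (f * g) s * of_bool (P s)) =
    (\<Sum>\<^sub>\<infinity>(t, u). l1_apply f t * l1_apply g u * of_bool (P (t * u)))"
proof -
  let ?h = "\<lambda>p. (\<lambda>(t, u). l1_apply f t * l1_apply g u) p * of_bool (P (case p of (t, u) \<Rightarrow> t * u))"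
  have h: "?h summable_on UNIV"
    by (rule of_bool_mult_summable) (use l1_mult_abs_summable in \<open>simp add: case_prod_unfold\<close>)
  have "l1_apply (f * g) s * of_bool (P s) = (\<Sum>\<^sub>\<infinity>p\<in>{p. (case p of (t, u) \<Rightarrow> t * u) = s}. ?h p)" for s
  proof -
    have fib: "{(t, u). t * u = s} = {p. (case p of (t, u) \<Rightarrow> t * u) = s}" by auto
    have "(\<Sum>\<^sub>\<infinity>p\<in>{p. (case p of (t, u) \<Rightarrow> t * u) = s}. ?h p) =
        (\<Sum>\<^sub>\<infinity>p\<in>{p. (case p of (t, u) \<Rightarrow> t * u) = s}. (\<lambda>(t, u). l1_apply f t * l1_apply g u) p * of_bool (P s))"
      by (rule infsum_cong) auto
    also have "\<dots> = (\<Sum>\<^sub>\<infinity>p\<in>{p. (case p of (t, u) \<Rightarrow> t * u) = s}. (\<lambda>(t, u). l1_apply f t * l1_apply g u) p) * of_bool (P s)"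
      by (rule infsum_cmult_left) (rule l1_mult_summable)
    finally show ?thesis by (simp add: times_l1.rep_eq fib)
  qed
  then have "(\<Sum>\<^sub>\<infinity>s. l1_apply (f * g) s * of_bool (P s)) = (\<Sum>\<^sub>\<infinity>p. ?h p)"
    using infsum_fibres[OF h, of "\<lambda>(t, u). t * u"] by simp
  then show ?thesis by (simp add: case_prod_unfold)
qed

lemma times_l1_assoc: "(f * g) * h = f * (g * h)" for f g h :: "'s::semigroup_mult l1"
proof (rule l1_eqI)
  fix s
  let ?P = "\<lambda>t u w. l1_apply f t * l1_apply g u * l1_apply h w * of_bool (t * u * w = s)"
  have fg: "(\<lambda>p. norm ((\<lambda>(t, u). l1_apply f t * l1_apply g u) p)) summable_on UNIV" for f g :: "'s l1"
    using l1_mult_abs_summable[of f g] by (simp add: case_prod_unfold)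
  have S: "(\<lambda>(v, w). l1_apply F v * l1_apply G w * of_bool (v * w = s)) summable_on UNIV" for F G :: "'s l1"
    using of_bool_mult_summable[OF fg, where P = "\<lambda>(v, w). v * w = s"] by (simp add: case_prod_unfold)
  have "(\<lambda>p. norm ((\<lambda>(w, (t, u)). l1_apply h w * (l1_apply f t * l1_apply g u)) p)) summable_on UNIV"
    using abs_summable_prod(1)[OF l1_abs_summable[of h] fg[of f g]] by (simp add: case_prod_unfold)
  from of_bool_mult_summable[OF this, where P = "\<lambda>(w, (t, u)). t * u * w = s"]
  have S1: "(\<lambda>(w, (t, u)). ?P t u w) summable_on UNIV"
    by (simp add: case_prod_unfold mult_ac)
  have "(\<lambda>p. norm ((\<lambda>(t, (u, w)). l1_apply f t * (l1_apply g u * l1_apply h w)) p)) summable_on UNIV"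
    using abs_summable_prod(1)[OF l1_abs_summable[of f] fg[of g h]] by (simp add: case_prod_unfold)
  from of_bool_mult_summable[OF this, where P = "\<lambda>(t, (u, w)). t * u * w = s"]
  have S2: "(\<lambda>(t, (u, w)). ?P t u w) summable_on UNIV"
    by (simp add: case_prod_unfold mult_ac)
  have "l1_apply ((f * g) * h) s = (\<Sum>\<^sub>\<infinity>(v, w). l1_apply (f * g) v * l1_apply h w * of_bool (v * w = s))"
    by (rule times_l1_of_bool)
  also have "\<dots> = (\<Sum>\<^sub>\<infinity>v. \<Sum>\<^sub>\<infinity>w. l1_apply (f * g) v * l1_apply h w * of_bool (v * w = s))"
    using infsum_Sigma'_banach[of "\<lambda>v w. l1_apply (f * g) v * l1_apply h w * of_bool (v * w = s)" UNIV "\<lambda>_. UNIV"]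
      S[of "f * g" h] by simp
  also have "\<dots> = (\<Sum>\<^sub>\<infinity>w. \<Sum>\<^sub>\<infinity>v. l1_apply (f * g) v * l1_apply h w * of_bool (v * w = s))"
    by (rule infsum_swap_banach) (use S[of "f * g" h] in simp)
  also have "\<dots> = (\<Sum>\<^sub>\<infinity>w. l1_apply h w * (\<Sum>\<^sub>\<infinity>v. l1_apply (f * g) v * of_bool (v * w = s)))"
    by (simp add: mult_ac flip: infsum_cmult_right')
  also have "\<dots> = (\<Sum>\<^sub>\<infinity>w. \<Sum>\<^sub>\<infinity>(t, u). ?P t u w)"
    by (simp add: times_l1_pairing mult_ac case_prod_unfold flip: infsum_cmult_right')
  also have "\<dots> = (\<Sum>\<^sub>\<infinity>(w, (t, u)). ?P t u w)"
    using infsum_Sigma'_banach[of "\<lambda>w (t, u). ?P t u w" UNIV "\<lambda>_. UNIV"] S1 by simp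
  also have "\<dots> = (\<Sum>\<^sub>\<infinity>(t, (u, w)). ?P t u w)"
    using infsum_reindex_bij_betw[of "\<lambda>(w, (t, u)). (t, (u, w))" UNIV UNIV "\<lambda>(t, (u, w)). ?P t u w"]
    by (simp add: case_prod_unfold bij_betw_def inj_on_def prod_eq_iff surj_def)
  also have "\<dots> = (\<Sum>\<^sub>\<infinity>t. \<Sum>\<^sub>\<infinity>(u, w). ?P t u w)"
    using infsum_Sigma'_banach[of "\<lambda>t (u, w). ?P t u w" UNIV "\<lambda>_. UNIV"] S2 by simp
  also have "\<dots> = (\<Sum>\<^sub>\<infinity>t. l1_apply f t * (\<Sum>\<^sub>\<infinity>v. l1_apply (g * h) v * of_bool (t * v = s)))"
    by (simp add: times_l1_pairing mult_ac case_prod_unfold flip: infsum_cmult_right')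
  also have "\<dots> = (\<Sum>\<^sub>\<infinity>t. \<Sum>\<^sub>\<infinity>v. l1_apply f t * l1_apply (g * h) v * of_bool (t * v = s))"
    by (simp add: mult_ac flip: infsum_cmult_right')
  also have "\<dots> = (\<Sum>\<^sub>\<infinity>(t, v). l1_apply f t * l1_apply (g * h) v * of_bool (t * v = s))"
    using infsum_Sigma'_banach[of "\<lambda>v w. l1_apply f v * l1_apply (g * h) w * of_bool (v * w = s)" UNIV "\<lambda>_. UNIV"]
      S[of f "g * h"] by simp
  also have "\<dots> = l1_apply (f * (g * h)) s"
    by (rule times_l1_of_bool[symmetric])
  finally show "l1_apply ((f * g) * h) s = l1_apply (f * (g * h)) s" .
qed

instance l1 :: (semigroup_mult) complex_banach_algebra
proof
  fix f g h :: "'a l1" and c :: complex and r :: real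
  show "f * g * h = f * (g * h)" by (rule times_l1_assoc)
  show "(f + g) * h = f * h + g * h"
    by (rule l1_eqI) (simp add: times_l1.rep_eq plus_l1.rep_eq ring_distribs case_prod_unfold
        infsum_add[OF l1_mult_summable[unfolded case_prod_unfold] l1_mult_summable[unfolded case_prod_unfold]])
  show "f * (g + h) = f * g + f * h"
    by (rule l1_eqI) (simp add: times_l1.rep_eq plus_l1.rep_eq ring_distribs case_prod_unfold
        infsum_add[OF l1_mult_summable[unfolded case_prod_unfold] l1_mult_summable[unfolded case_prod_unfold]])
  show left: "(c *\<^sub>C f) * g = c *\<^sub>C (f * g)" for c
    by (rule l1_eqI) (simp add: times_l1.rep_eq scaleC_l1.rep_eq case_prod_unfold mult.assoc infsum_cmult_right')
  show right: "f * (c *\<^sub>C g) = c *\<^sub>C (f * g)" for c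
    by (rule l1_eqI) (simp add: times_l1.rep_eq scaleC_l1.rep_eq case_prod_unfold mult.left_commute infsum_cmult_right')
  show "(r *\<^sub>R f) * g = r *\<^sub>R (f * g)" by (simp add: scaleR_l1_def left)
  show "f * (r *\<^sub>R g) = r *\<^sub>R (f * g)" by (simp add: scaleR_l1_def right)
  show "norm (f * g) \<le> norm f * norm g"
    by transfer (rule conv_norm_le)
qed

lift_definition l1_delta :: "'s \<Rightarrow> 's l1" is "\<lambda>s t. of_bool (t = s)"
  by (rule finite_nonzero_values_imp_summable_on) simp

lemma l1_delta_mult: "l1_delta s * l1_delta t = l1_delta (s * t)" for s t :: "'s::semigroup_mult"
proof (rule l1_eqI)
  fix r :: 's
  have "l1_apply (l1_delta s * l1_delta t) r =
      (\<Sum>\<^sub>\<infinity>p\<in>{(s, t)}. case p of (x, y) \<Rightarrow> of_bool (x = s) * of_bool (y = t) * of_bool (x * y = r))"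
    unfolding times_l1_of_bool l1_delta.rep_eq by (rule infsum_cong_neutral) auto
  then show "l1_apply (l1_delta s * l1_delta t) r = l1_apply (l1_delta (s * t)) r"
    by (auto simp: l1_delta.rep_eq)
qed

section \<open>Adjoints, dual modules and the second dual\<close>

definition adjoint_map :: "('a::complex_normed_vector \<Rightarrow> 'b::complex_normed_vector) \<Rightarrow> 'b cdual \<Rightarrow> 'a cdual"
  where "adjoint_map T f = Cdual (\<lambda>x. cdual_apply f (T x))"

lemma cdual_apply_adjoint_map:
  "bounded_clinear T \<Longrightarrow> cdual_apply (adjoint_map T f) x = cdual_apply f (T x)"
  unfolding adjoint_map_def
  by (subst cdual_apply_Cdual) (auto intro: bounded_clinear_compose bounded_clinear_cdual_apply)

lemma bounded_clinear_adjoint_map: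
  assumes T: "bounded_clinear T"
  shows "bounded_clinear (adjoint_map T)"
proof -
  obtain K where K: "K \<ge> 0" "\<And>x. norm (T x) \<le> norm x * K"
    using bounded_linear.nonneg_bounded[OF bounded_clinear_linear[OF T]] by blast
  show ?thesis
  proof (rule bounded_clinearI)
    show "adjoint_map T (f + g) = adjoint_map T f + adjoint_map T g" for f g
      by (rule cdual_eqI) (simp add: cdual_apply_adjoint_map[OF T] plus_cdual.rep_eq)
    show "adjoint_map T (c *\<^sub>C f) = c *\<^sub>C adjoint_map T f" for c f
      by (rule cdual_eqI) (simp add: cdual_apply_adjoint_map[OF T] scaleC_cdual.rep_eq)
    show "norm (adjoint_map T f) \<le> norm f * K" for f
    proof (rule norm_cdual_bound)
      show "norm (cdual_apply (adjoint_map T f) x) \<le> norm f * K * norm x" for x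
        using norm_cdual_apply_le[of f "T x"] mult_left_mono[OF K(2)[of x] norm_ge_zero[of f]]
        by (simp add: cdual_apply_adjoint_map[OF T] mult_ac)
    qed (use K in simp)
  qed
qed

definition bidual_embed :: "'a::complex_normed_vector \<Rightarrow> 'a cdual cdual"
  where "bidual_embed x = Cdual (\<lambda>f. cdual_apply f x)"

lemma cdual_apply_bidual_embed: "cdual_apply (bidual_embed x) f = cdual_apply f x"
proof -
  have "bounded_clinear (\<lambda>f. cdual_apply f x)"
    by (rule bounded_clinearI[where K = "norm x"])
      (auto simp: plus_cdual.rep_eq scaleC_cdual.rep_eq scaleC_complex_def norm_cdual_apply_le)
  then show ?thesis by (simp add: bidual_embed_def cdual_apply_Cdual)
qed

text \<open>
  A module action of \<open>'a\<close> on \<open>'x\<close> is passed as a function, \<open>l a x\<close> for \<open>a \<cdot> x\<close> and \<open>r x a\<close> for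
  \<open>x \<cdot> a\<close>. The dual actions are \<open>(a \<cdot> f)(x) = f(x \<cdot> a)\<close> and \<open>(f \<cdot> a)(x) = f(a \<cdot> x)\<close>.
\<close>

definition dual_left :: "('x::complex_normed_vector \<Rightarrow> 'a \<Rightarrow> 'x) \<Rightarrow> 'a \<Rightarrow> 'x cdual \<Rightarrow> 'x cdual"
  where "dual_left r a f = adjoint_map (\<lambda>x. r x a) f"

definition dual_right :: "('a \<Rightarrow> 'x::complex_normed_vector \<Rightarrow> 'x) \<Rightarrow> 'x cdual \<Rightarrow> 'a \<Rightarrow> 'x cdual"
  where "dual_right l f a = adjoint_map (\<lambda>x. l a x) f"

definition bidual_left ::
    "('a \<Rightarrow> 'x::complex_normed_vector \<Rightarrow> 'x) \<Rightarrow> 'a \<Rightarrow> 'x cdual cdual \<Rightarrow> 'x cdual cdual"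
  where "bidual_left l = dual_left (dual_right l)"

definition bidual_right ::
    "('x::complex_normed_vector \<Rightarrow> 'a \<Rightarrow> 'x) \<Rightarrow> 'x cdual cdual \<Rightarrow> 'a \<Rightarrow> 'x cdual cdual"
  where "bidual_right r = dual_right (dual_left r)"

subsection \<open>The first Arens product\<close>

abbreviation functional_mult :: "'a::complex_banach_algebra cdual \<Rightarrow> 'a \<Rightarrow> 'a cdual"
  where "functional_mult \<equiv> dual_right (*)"

lemma cdual_apply_functional_mult: "cdual_apply (functional_mult f a) b = cdual_apply f (a * b)"
  by (simp add: dual_right_def cdual_apply_adjoint_map bounded_cbilinear_right[OF bounded_cbilinear_mult])

definition arens_functional ::
    "'a::complex_banach_algebra cdual cdual \<Rightarrow> 'a cdual \<Rightarrow> 'a cdual"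
  where "arens_functional H f = Cdual (\<lambda>a. cdual_apply H (functional_mult f a))"

definition arens_mult ::
    "'a::complex_banach_algebra cdual cdual \<Rightarrow> 'a cdual cdual \<Rightarrow> 'a cdual cdual"
  where "arens_mult F H = Cdual (\<lambda>f. cdual_apply F (arens_functional H f))"

lemma norm_functional_mult_le: "norm (functional_mult f a) \<le> norm f * norm a"
proof (rule norm_cdual_bound)
  show "norm (cdual_apply (functional_mult f a) b) \<le> norm f * norm a * norm b" for b
    using norm_cdual_apply_le[of f "a * b"] mult_left_mono[OF norm_mult_ineq[of a b] norm_ge_zero[of f]]
    by (simp add: cdual_apply_functional_mult mult_ac)
qed simp

lemma functional_mult_linear:
  "functional_mult (f + g) a = functional_mult f a + functional_mult g a"
  "functional_mult f (a + b) = functional_mult f a + functional_mult f b"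
  "functional_mult (c *\<^sub>C f) a = c *\<^sub>C functional_mult f a"
  "functional_mult f (c *\<^sub>C a) = c *\<^sub>C functional_mult f a"
  by (auto intro!: cdual_eqI simp: cdual_apply_functional_mult plus_cdual.rep_eq scaleC_cdual.rep_eq
      ring_distribs mult_scaleC_left bounded_clinear_scaleC[OF bounded_clinear_cdual_apply] scaleC_complex_def
      linear_add[OF bounded_linear.linear[OF bounded_linear_cdual_apply]])

lemma cdual_apply_add: "cdual_apply f (x + y) = cdual_apply f x + cdual_apply f y"
  by (rule linear_add[OF bounded_linear.linear[OF bounded_linear_cdual_apply]])

lemma cdual_apply_scaleC: "cdual_apply f (c *\<^sub>C x) = c * cdual_apply f x"
  by (simp add: bounded_clinear_scaleC[OF bounded_clinear_cdual_apply] scaleC_complex_def)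

lemma cdual_apply_arens_functional:
  "cdual_apply (arens_functional H f) a = cdual_apply H (functional_mult f a)"
proof -
  have "bounded_clinear (\<lambda>a. cdual_apply H (functional_mult f a))"
  proof (rule bounded_clinearI[where K = "norm H * norm f"])
    show "norm (cdual_apply H (functional_mult f a)) \<le> norm a * (norm H * norm f)" for a
      using norm_cdual_apply_le[of H "functional_mult f a"]
        mult_left_mono[OF norm_functional_mult_le[of f a] norm_ge_zero[of H]]
      by (simp add: mult_ac)
  qed (simp_all add: functional_mult_linear cdual_apply_add cdual_apply_scaleC scaleC_complex_def)
  then show ?thesis by (simp add: arens_functional_def cdual_apply_Cdual)
qed

lemma norm_arens_functional_le: "norm (arens_functional H f) \<le> norm H * norm f"
proof (rule norm_cdual_bound)
  show "norm (cdual_apply (arens_functional H f) a) \<le> norm H * norm f * norm a" for a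
    using norm_cdual_apply_le[of H "functional_mult f a"]
      mult_left_mono[OF norm_functional_mult_le[of f a] norm_ge_zero[of H]]
    by (simp add: cdual_apply_arens_functional mult_ac)
qed simp

lemma cdual_apply_arens_mult:
  "cdual_apply (arens_mult F H) f = cdual_apply F (arens_functional H f)"
proof -
  have 1: "arens_functional H (f + g) = arens_functional H f + arens_functional H g" for f g
    by (rule cdual_eqI)
      (simp add: cdual_apply_arens_functional functional_mult_linear plus_cdual.rep_eq cdual_apply_add)
  have 2: "arens_functional H (c *\<^sub>C f) = c *\<^sub>C arens_functional H f" for c f
    by (rule cdual_eqI)
      (simp add: cdual_apply_arens_functional functional_mult_linear scaleC_cdual.rep_eq cdual_apply_scaleC)
  have "bounded_clinear (\<lambda>f. cdual_apply F (arens_functional H f))"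
  proof (rule bounded_clinearI[where K = "norm F * norm H"])
    show "norm (cdual_apply F (arens_functional H f)) \<le> norm f * (norm F * norm H)" for f
      using norm_cdual_apply_le[of F "arens_functional H f"]
        mult_left_mono[OF norm_arens_functional_le[of H f] norm_ge_zero[of F]]
      by (simp add: mult_ac)
  qed (simp_all add: 1 2 cdual_apply_add cdual_apply_scaleC scaleC_complex_def)
  then show ?thesis by (simp add: arens_mult_def cdual_apply_Cdual)
qed

lemma norm_arens_mult_le: "norm (arens_mult F H) \<le> norm F * norm H"
proof (rule norm_cdual_bound)
  show "norm (cdual_apply (arens_mult F H) f) \<le> norm F * norm H * norm f" for f
    using norm_cdual_apply_le[of F "arens_functional H f"]
      mult_left_mono[OF norm_arens_functional_le[of H f] norm_ge_zero[of F]]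
    by (simp add: cdual_apply_arens_mult mult_ac)
qed simp

lemma arens_mult_assoc: "arens_mult (arens_mult F G) H = arens_mult F (arens_mult G H)"
proof -
  have fm: "functional_mult (functional_mult f a) b = functional_mult f (a * b)" for f :: "'a cdual" and a b
    by (rule cdual_eqI) (simp add: cdual_apply_functional_mult mult.assoc)
  have "functional_mult (arens_functional H f) a = arens_functional H (functional_mult f a)" for f a
    by (rule cdual_eqI) (simp add: cdual_apply_functional_mult cdual_apply_arens_functional fm)
  then have "arens_functional (arens_mult G H) f = arens_functional G (arens_functional H f)" for f
    by (intro cdual_eqI) (simp add: cdual_apply_arens_functional cdual_apply_arens_mult)
  then show ?thesis
    by (intro cdual_eqI) (simp add: cdual_apply_arens_mult)
qed

text \<open>The Banach space \<open>'a cdual cdual\<close>, as a type of its own that carries the first Arens product.\<close>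

typedef (overloaded) 'a second_dual = "UNIV :: 'a::complex_banach_algebra cdual cdual set"
  morphisms functional_of Second_dual ..

setup_lifting type_definition_second_dual

instantiation second_dual :: (complex_banach_algebra) complex_normed_vector
begin

lift_definition zero_second_dual :: "'a second_dual" is 0 .
lift_definition plus_second_dual :: "'a second_dual \<Rightarrow> 'a second_dual \<Rightarrow> 'a second_dual" is "(+)" .
lift_definition uminus_second_dual :: "'a second_dual \<Rightarrow> 'a second_dual" is uminus .
lift_definition minus_second_dual :: "'a second_dual \<Rightarrow> 'a second_dual \<Rightarrow> 'a second_dual" is "(-)" .
lift_definition scaleC_second_dual :: "complex \<Rightarrow> 'a second_dual \<Rightarrow> 'a second_dual" is scaleC .
lift_definition scaleR_second_dual :: "real \<Rightarrow> 'a second_dual \<Rightarrow> 'a second_dual" is scaleR .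
lift_definition norm_second_dual :: "'a second_dual \<Rightarrow> real" is norm .

definition dist_second_dual :: "'a second_dual \<Rightarrow> 'a second_dual \<Rightarrow> real"
  where "dist_second_dual F G = norm (F - G)"

definition sgn_second_dual :: "'a second_dual \<Rightarrow> 'a second_dual"
  where "sgn_second_dual F = scaleR (inverse (norm F)) F"

definition uniformity_second_dual :: "('a second_dual \<times> 'a second_dual) filter"
  where "uniformity_second_dual = (INF e\<in>{0 <..}. principal {(x, y). dist x y < e})"

definition open_second_dual :: "'a second_dual set \<Rightarrow> bool"
  where "open_second_dual U \<longleftrightarrow> (\<forall>x\<in>U. \<forall>\<^sub>F (x', y) in uniformity. x' = x \<longrightarrow> y \<in> U)"

instance
proof
  fix F G H :: "'a second_dual" and c d :: complex and r s :: real
  show "F + G + H = F + (G + H)" by transfer (simp add: algebra_simps)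
  show "F + G = G + F" by transfer (simp add: algebra_simps)
  show "0 + F = F" by transfer simp
  show "- F + F = 0" by transfer simp
  show "F - G = F + - G" by transfer simp
  show "r *\<^sub>R (F + G) = r *\<^sub>R F + r *\<^sub>R G" by transfer (simp add: algebra_simps)
  show "(r + s) *\<^sub>R F = r *\<^sub>R F + s *\<^sub>R F" by transfer (simp add: algebra_simps)
  show "r *\<^sub>R s *\<^sub>R F = (r * s) *\<^sub>R F" by transfer simp
  show "1 *\<^sub>R F = F" by transfer simp
  show "c *\<^sub>C (F + G) = c *\<^sub>C F + c *\<^sub>C G" by transfer (rule scaleC_add_right)
  show "(c + d) *\<^sub>C F = c *\<^sub>C F + d *\<^sub>C F" by transfer (rule scaleC_add_left)
  show "c *\<^sub>C d *\<^sub>C F = (c * d) *\<^sub>C F" by transfer (rule scaleC_scaleC)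
  show "r *\<^sub>R F = complex_of_real r *\<^sub>C F" by transfer (rule scaleR_scaleC)
  show "dist F G = norm (F - G)" by (rule dist_second_dual_def)
  show "sgn F = scaleR (inverse (norm F)) F" by (rule sgn_second_dual_def)
  show "(uniformity :: ('a second_dual \<times> 'a second_dual) filter) = (INF e\<in>{0 <..}. principal {(x, y). dist x y < e})"
    by (rule uniformity_second_dual_def)
  show "open U \<longleftrightarrow> (\<forall>x\<in>U. \<forall>\<^sub>F (x', y) in uniformity. x' = x \<longrightarrow> y \<in> U)" for U :: "'a second_dual set"
    by (rule open_second_dual_def)
  show "(norm F = 0) = (F = 0)" by transfer simp
  show "norm (F + G) \<le> norm F + norm G" by transfer (rule norm_triangle_ineq)
  show "norm (c *\<^sub>C F) = norm c * norm F" by transfer (rule norm_scaleC)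
  show "norm (r *\<^sub>R F) = \<bar>r\<bar> * norm F" by transfer simp
qed

end

instantiation second_dual :: (complex_banach_algebra) complex_banach_algebra
begin

lift_definition times_second_dual :: "'a second_dual \<Rightarrow> 'a second_dual \<Rightarrow> 'a second_dual" is arens_mult .

instance
proof
  fix F G H :: "'a second_dual" and c :: complex and r :: real
  show "F * G * H = F * (G * H)" by transfer (rule arens_mult_assoc)
  show "(F + G) * H = F * H + G * H"
    by transfer (rule cdual_eqI, simp add: cdual_apply_arens_mult plus_cdual.rep_eq)
  have add: "arens_functional (G + H) f = arens_functional G f + arens_functional H f"
    for G H :: "'a cdual cdual" and f
    by (rule cdual_eqI) (simp add: cdual_apply_arens_functional plus_cdual.rep_eq)
  have scale: "arens_functional (c *\<^sub>C H) f = c *\<^sub>C arens_functional H f"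
    for c and H :: "'a cdual cdual" and f
    by (rule cdual_eqI) (simp add: cdual_apply_arens_functional scaleC_cdual.rep_eq)
  show "F * (G + H) = F * G + F * H"
    by transfer (rule cdual_eqI, simp add: cdual_apply_arens_mult plus_cdual.rep_eq add cdual_apply_add)
  show left: "(c *\<^sub>C F) * G = c *\<^sub>C (F * G)" for c
    by transfer (rule cdual_eqI, simp add: cdual_apply_arens_mult scaleC_cdual.rep_eq)
  show right: "F * (c *\<^sub>C G) = c *\<^sub>C (F * G)" for c
    by transfer (rule cdual_eqI, simp add: cdual_apply_arens_mult scaleC_cdual.rep_eq scale cdual_apply_scaleC)
  show "(r *\<^sub>R F) * G = r *\<^sub>R (F * G)" by (simp add: scaleR_scaleC left)
  show "F * (r *\<^sub>R G) = r *\<^sub>R (F * G)" by (simp add: scaleR_scaleC right)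
  show "norm (F * G) \<le> norm F * norm G" by transfer (rule norm_arens_mult_le)
  show "convergent X" if X: "Cauchy X" for X :: "nat \<Rightarrow> 'a second_dual"
  proof -
    have nd: "norm (functional_of F - functional_of G) = norm (F - G)" for F G :: "'a second_dual"
      by transfer simp
    have "Cauchy (\<lambda>n. functional_of (X n))"
      using X by (simp add: Cauchy_iff nd)
    then obtain L where "(\<lambda>n. functional_of (X n)) \<longlonglongrightarrow> L"
      using Cauchy_convergent convergent_def by blast
    moreover have "L = functional_of (Second_dual L)" by (simp add: Second_dual_inverse)
    ultimately have "X \<longlonglongrightarrow> Second_dual L" by (metis LIMSEQ_iff nd)
    then show ?thesis by (auto simp: convergent_def)
  qed
qed

end

section \<open>The unitization\<close>

text \<open>A unit is always adjoined, also if the algebra already has one.\<close>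

typedef (overloaded) 'a unitization = "UNIV :: ('a::complex_banach_algebra \<times> complex) set"
  morphisms unitization_rep Unitization ..

setup_lifting type_definition_unitization

instantiation unitization :: (complex_banach_algebra) complex_normed_vector
begin

lift_definition zero_unitization :: "'a unitization" is "(0, 0)" .
lift_definition plus_unitization :: "'a unitization \<Rightarrow> 'a unitization \<Rightarrow> 'a unitization"
  is "\<lambda>(a, c) (b, d). (a + b, c + d)" .
lift_definition uminus_unitization :: "'a unitization \<Rightarrow> 'a unitization" is "\<lambda>(a, c). (- a, - c)" .
lift_definition minus_unitization :: "'a unitization \<Rightarrow> 'a unitization \<Rightarrow> 'a unitization"
  is "\<lambda>(a, c) (b, d). (a - b, c - d)" .
lift_definition scaleC_unitization :: "complex \<Rightarrow> 'a unitization \<Rightarrow> 'a unitization"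
  is "\<lambda>k (a, c). (k *\<^sub>C a, k * c)" .
lift_definition scaleR_unitization :: "real \<Rightarrow> 'a unitization \<Rightarrow> 'a unitization"
  is "\<lambda>k (a, c). (k *\<^sub>R a, k *\<^sub>R c)" .
lift_definition norm_unitization :: "'a unitization \<Rightarrow> real" is "\<lambda>(a, c). norm a + norm c" .

definition dist_unitization :: "'a unitization \<Rightarrow> 'a unitization \<Rightarrow> real"
  where "dist_unitization x y = norm (x - y)"

definition sgn_unitization :: "'a unitization \<Rightarrow> 'a unitization"
  where "sgn_unitization x = scaleR (inverse (norm x)) x"

definition uniformity_unitization :: "('a unitization \<times> 'a unitization) filter"
  where "uniformity_unitization = (INF e\<in>{0 <..}. principal {(x, y). dist x y < e})"

definition open_unitization :: "'a unitization set \<Rightarrow> bool"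
  where "open_unitization U \<longleftrightarrow> (\<forall>x\<in>U. \<forall>\<^sub>F (x', y) in uniformity. x' = x \<longrightarrow> y \<in> U)"

instance
proof
  fix x y z :: "'a unitization" and c d :: complex and r s :: real
  show "x + y + z = x + (y + z)" by transfer (auto simp: algebra_simps)
  show "x + y = y + x" by transfer (auto simp: algebra_simps)
  show "0 + x = x" by transfer auto
  show "- x + x = 0" by transfer auto
  show "x - y = x + - y" by transfer auto
  show "r *\<^sub>R (x + y) = r *\<^sub>R x + r *\<^sub>R y" by transfer (auto simp: algebra_simps)
  show "(r + s) *\<^sub>R x = r *\<^sub>R x + s *\<^sub>R x" by transfer (auto simp: algebra_simps)
  show "r *\<^sub>R s *\<^sub>R x = (r * s) *\<^sub>R x" by transfer auto
  show "1 *\<^sub>R x = x" by transfer auto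
  show "c *\<^sub>C (x + y) = c *\<^sub>C x + c *\<^sub>C y" by transfer (auto simp: scaleC_add_right algebra_simps)
  show "(c + d) *\<^sub>C x = c *\<^sub>C x + d *\<^sub>C x" by transfer (auto simp: scaleC_add_left algebra_simps)
  show "c *\<^sub>C d *\<^sub>C x = (c * d) *\<^sub>C x" by transfer (auto simp: scaleC_scaleC)
  show "r *\<^sub>R x = complex_of_real r *\<^sub>C x" by transfer (auto simp: scaleR_scaleC scaleC_complex_def)
  show "dist x y = norm (x - y)" by (rule dist_unitization_def)
  show "sgn x = scaleR (inverse (norm x)) x" by (rule sgn_unitization_def)
  show "(uniformity :: ('a unitization \<times> 'a unitization) filter) = (INF e\<in>{0 <..}. principal {(x, y). dist x y < e})"
    by (rule uniformity_unitization_def)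
  show "open U \<longleftrightarrow> (\<forall>x\<in>U. \<forall>\<^sub>F (x', y) in uniformity. x' = x \<longrightarrow> y \<in> U)" for U :: "'a unitization set"
    by (rule open_unitization_def)
  show "(norm x = 0) = (x = 0)"
    by transfer (auto simp: add_nonneg_eq_0_iff)
  have tri: "norm (a + b) + norm (c + d) \<le> norm a + norm c + (norm b + norm d)" for a b :: 'a and c d :: complex
    using norm_triangle_ineq[of a b] norm_triangle_ineq[of c d] by linarith
  show "norm (x + y) \<le> norm x + norm y" by transfer (auto intro: tri)
  show "norm (c *\<^sub>C x) = norm c * norm x" by transfer (auto simp: norm_scaleC norm_mult algebra_simps)
  show "norm (r *\<^sub>R x) = \<bar>r\<bar> * norm x" by transfer (auto simp: algebra_simps)
qed

end

instantiation unitization :: (complex_banach_algebra) complex_banach_algebra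
begin

lift_definition times_unitization :: "'a unitization \<Rightarrow> 'a unitization \<Rightarrow> 'a unitization"
  is "\<lambda>(a, c) (b, d). (a * b + d *\<^sub>C a + c *\<^sub>C b, c * d)" .

instance
proof
  fix x y z :: "'a unitization" and c :: complex and r :: real
  show "x * y * z = x * (y * z)"
    by transfer (auto simp: ring_distribs mult_scaleC_left mult_scaleC_right scaleC_add_right scaleC_scaleC mult_ac)
  show "(x + y) * z = x * z + y * z"
    by transfer (auto simp: ring_distribs scaleC_add_right scaleC_add_left add_ac)
  show "x * (y + z) = x * y + x * z"
    by transfer (auto simp: ring_distribs scaleC_add_right scaleC_add_left add_ac)
  show left: "(c *\<^sub>C x) * y = c *\<^sub>C (x * y)" for c
    by transfer (auto simp: mult_scaleC_left scaleC_add_right scaleC_scaleC mult_ac)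
  show right: "x * (c *\<^sub>C y) = c *\<^sub>C (x * y)" for c
    by transfer (auto simp: mult_scaleC_right scaleC_add_right scaleC_scaleC mult_ac)
  show "(r *\<^sub>R x) * y = r *\<^sub>R (x * y)" by (simp add: scaleR_scaleC left)
  show "x * (r *\<^sub>R y) = r *\<^sub>R (x * y)" by (simp add: scaleR_scaleC right)
  have "norm (a * b + d *\<^sub>C a + c *\<^sub>C b) + norm (c * d) \<le> (norm a + norm c) * (norm b + norm d)"
    for a b :: 'a and c d :: complex
    using norm_triangle_ineq[of "a * b + d *\<^sub>C a" "c *\<^sub>C b"] norm_triangle_ineq[of "a * b" "d *\<^sub>C a"]
      norm_mult_ineq[of a b] by (simp add: norm_scaleC norm_mult algebra_simps)
  then show "norm (x * y) \<le> norm x * norm y" by transfer auto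
  show "convergent X" if X: "Cauchy X" for X :: "nat \<Rightarrow> 'a unitization"
  proof -
    let ?a = "\<lambda>x. fst (unitization_rep x)" and ?c = "\<lambda>x. snd (unitization_rep x)"
    have nd: "norm (x - y) = norm (?a x - ?a y) + norm (?c x - ?c y)" for x y :: "'a unitization"
      by transfer auto
    have le: "norm (?a x - ?a y) \<le> norm (x - y)" "norm (?c x - ?c y) \<le> norm (x - y)" for x y :: "'a unitization"
      by (simp_all add: nd)
    have "Cauchy (\<lambda>n. ?a (X n))" "Cauchy (\<lambda>n. ?c (X n))"
      using X unfolding Cauchy_iff by (meson le order.strict_trans1)+
    then obtain a c where a: "(\<lambda>n. ?a (X n)) \<longlonglongrightarrow> a" and c: "(\<lambda>n. ?c (X n)) \<longlonglongrightarrow> c"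
      by (auto simp: Cauchy_convergent_iff convergent_def)
    have "(\<lambda>n. norm (?a (X n) - a) + norm (?c (X n) - c)) \<longlonglongrightarrow> 0 + 0"
      by (intro tendsto_add tendsto_norm_zero LIM_zero a c)
    then have "(\<lambda>n. norm (X n - Unitization (a, c))) \<longlonglongrightarrow> 0"
      by (simp add: nd Unitization_inverse)
    then have "X \<longlonglongrightarrow> Unitization (a, c)"
      by (metis LIM_zero_cancel tendsto_norm_zero_cancel)
    then show ?thesis by (auto simp: convergent_def)
  qed
qed

end

section \<open>Notions of amenability\<close>

definition tensor_left :: "'a::complex_banach_algebra \<Rightarrow> ('a, 'a) ptensor \<Rightarrow> ('a, 'a) ptensor"
  where "tensor_left a = tensor_lift (\<lambda>b c. (a * b) \<otimes>\<^sub>p c)"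

definition tensor_right :: "('a::complex_banach_algebra, 'a) ptensor \<Rightarrow> 'a \<Rightarrow> ('a, 'a) ptensor"
  where "tensor_right u a = tensor_lift (\<lambda>b c. b \<otimes>\<^sub>p (c * a)) u"

definition mult_map :: "('a::complex_banach_algebra, 'a) ptensor \<Rightarrow> 'a"
  where "mult_map = tensor_lift (*)"

lemma bounded_cbilinear_compose:
  assumes \<beta>: "bounded_cbilinear \<beta>" and S: "bounded_clinear S" and T: "bounded_clinear T"
  shows "bounded_cbilinear (\<lambda>x y. \<beta> (S x) (T y))"
  using assms unfolding bounded_cbilinear_def bounded_clinear_def
  by (auto intro: bounded_bilinear.comp)

lemma bounded_clinear_id: "bounded_clinear (\<lambda>x. x)"
  by (simp add: bounded_clinear_def bounded_linear_ident)

lemma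
  shows bounded_clinear_tensor_left: "bounded_clinear (tensor_left a)"
    and tensor_left_tensor: "tensor_left a (b \<otimes>\<^sub>p c) = (a * b) \<otimes>\<^sub>p c"
proof -
  have "bounded_cbilinear (\<lambda>b c. (a * b) \<otimes>\<^sub>p c)"
    by (rule bounded_cbilinear_compose[OF bounded_cbilinear_tensor
          bounded_cbilinear_right[OF bounded_cbilinear_mult] bounded_clinear_id])
  from bounded_clinear_tensor_lift[OF this] tensor_lift_tensor[OF this]
  show "bounded_clinear (tensor_left a)" "tensor_left a (b \<otimes>\<^sub>p c) = (a * b) \<otimes>\<^sub>p c"
    by (simp_all add: tensor_left_def)
qed

lemma
  shows bounded_clinear_tensor_right: "bounded_clinear (\<lambda>u. tensor_right u a)"
    and tensor_right_tensor: "tensor_right (b \<otimes>\<^sub>p c) a = b \<otimes>\<^sub>p (c * a)"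
proof -
  have "bounded_cbilinear (\<lambda>b c. b \<otimes>\<^sub>p (c * a))"
    by (rule bounded_cbilinear_compose[OF bounded_cbilinear_tensor
          bounded_clinear_id bounded_cbilinear_left[OF bounded_cbilinear_mult]])
  from bounded_clinear_tensor_lift[OF this] tensor_lift_tensor[OF this]
  show "bounded_clinear (\<lambda>u. tensor_right u a)" "tensor_right (b \<otimes>\<^sub>p c) a = b \<otimes>\<^sub>p (c * a)"
    by (simp_all add: tensor_right_def)
qed

lemma bounded_clinear_mult_map: "bounded_clinear mult_map"
  by (simp add: mult_map_def bounded_clinear_tensor_lift bounded_cbilinear_mult)

lemma mult_map_tensor: "mult_map (a \<otimes>\<^sub>p b) = a * b"
  by (simp add: mult_map_def tensor_lift_tensor bounded_cbilinear_mult)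

text \<open>
  The nets in the following definitions are represented by proper filters on the space they live
  in: the filter of a net is generated by its tails, and conversely a proper filter \<open>\<F>\<close> is the
  filter of a net indexed by the pairs \<open>(P, m)\<close> with \<open>P \<in> \<F>\<close> and \<open>m \<in> P\<close>.
\<close>

definition johnson_pseudo_contractible :: "'a::complex_banach_algebra itself \<Rightarrow> bool"
  where "johnson_pseudo_contractible _ \<longleftrightarrow>
    (\<exists>\<F> :: ('a, 'a) ptensor cdual cdual filter. \<F> \<noteq> bot \<and>
      (\<forall>\<^sub>F m in \<F>. \<forall>a. bidual_left tensor_left a m = bidual_right tensor_right m a) \<and>
      (\<forall>a. ((\<lambda>m. bidual_right (*) (adjoint_map (adjoint_map mult_map) m) a - bidual_embed a) \<longlongrightarrow> 0) \<F>))"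

definition pseudo_amenable :: "'a::complex_banach_algebra itself \<Rightarrow> bool"
  where "pseudo_amenable _ \<longleftrightarrow>
    (\<exists>\<F> :: ('a, 'a) ptensor filter. \<F> \<noteq> bot \<and>
      (\<forall>a. ((\<lambda>m. tensor_left a m - tensor_right m a) \<longlongrightarrow> 0) \<F>) \<and>
      (\<forall>a. ((\<lambda>m. mult_map m * a - a) \<longlongrightarrow> 0) \<F>))"

text \<open>
  The usual definition (all continuous derivations into dual Banach bimodules are approximately
  inner) quantifies over all bimodules; this is its characterization by the unitization.
\<close>
definition approximately_amenable :: "'a::complex_banach_algebra itself \<Rightarrow> bool"
  where "approximately_amenable _ \<longleftrightarrow> pseudo_amenable TYPE('a unitization)"

section \<open>The semigroup of natural numbers with maximum\<close>

datatype nat_vee = Vee nat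

instantiation nat_vee :: semigroup_mult
begin

fun times_nat_vee :: "nat_vee \<Rightarrow> nat_vee \<Rightarrow> nat_vee"
  where "Vee m * Vee n = Vee (max m n)"

instance
proof
  show "x * y * z = x * (y * z)" for x y z :: nat_vee
    by (cases x; cases y; cases z) (simp add: max.assoc)
qed

end

end

theory Submission
  imports Defs
begin

text \<open>
  Failure of Johnson pseudo-contractibility: let \<open>m\<close> be a commuting element of the bidual of the
  tensor square with \<open>\<pi>\<^sup>*\<^sup>*(m)\<close> close to the identity, and let \<open>\<phi>\<^sub>n(f) = \<Sum>k\<le>n. f k\<close>. Commutation forces
  \<open>m(\<phi>\<^sub>i \<otimes> \<phi>\<^sub>j) = 0\<close> for \<open>i \<noteq> j\<close>, whereas \<open>m(\<phi>\<^sub>i \<otimes> \<phi>\<^sub>i)\<close> is close to \<open>1\<close>. As \<open>\<phi>\<^sub>i\<^sub>+\<^sub>1 - \<phi>\<^sub>i\<close> is a coordinate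
  functional, the functionals \<open>\<Sum>i<N. (\<phi>\<^sub>i\<^sub>+\<^sub>1 - \<phi>\<^sub>i) \<otimes> (\<phi>\<^sub>i\<^sub>+\<^sub>1 - \<phi>\<^sub>i)\<close> have norm at most \<open>1\<close>, but \<open>m\<close> takes
  values of modulus at least \<open>N\<close> on them. The characters extend to the second dual with the same
  bound.

  Pseudo-amenability: the span of \<open>\<delta>\<^sub>0, \<dots>, \<delta>\<^sub>n\<close> is isomorphic to a power of \<open>\<complex>\<close>, with minimal
  idempotents \<open>\<delta>\<^sub>i - \<delta>\<^sub>i\<^sub>+\<^sub>1\<close> (\<open>i < n\<close>) and \<open>\<delta>\<^sub>n\<close>; let \<open>d\<^sub>n\<close> be its diagonal. Although \<open>d\<^sub>n\<close> is unbounded,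
  \<open>a \<cdot> d\<^sub>n - d\<^sub>n \<cdot> a = a\<delta>\<^sub>n \<otimes> \<delta>\<^sub>n - \<delta>\<^sub>n \<otimes> \<delta>\<^sub>na\<close> is bounded uniformly in \<open>n\<close>, and it vanishes for \<open>a = \<delta>\<^sub>k\<close>,
  \<open>k \<le> n\<close>. The unitization is covered by adding one more element below \<open>\<delta>\<^sub>0\<close>.
\<close>

section \<open>Dual spaces and tensor products\<close>

lemma cdual_apply_diff: "cdual_apply f (x - y) = cdual_apply f x - cdual_apply f y"
  by (rule linear_diff[OF bounded_linear.linear[OF bounded_linear_cdual_apply]])

lemma cdual_apply_sum: "cdual_apply f (\<Sum>i\<in>I. x i) = (\<Sum>i\<in>I. cdual_apply f (x i))"
  by (rule linear_sum[OF bounded_linear.linear[OF bounded_linear_cdual_apply]])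

lemma sum_cdual_apply: "cdual_apply (\<Sum>i\<in>I. f i) x = (\<Sum>i\<in>I. cdual_apply (f i) x)"
  by (induction I rule: infinite_finite_induct) (auto simp: zero_cdual.rep_eq plus_cdual.rep_eq)

lemma cdual_ptensor_eqI:
  assumes "\<And>a b. cdual_apply f (a \<otimes>\<^sub>p b) = cdual_apply g (a \<otimes>\<^sub>p b)"
  shows "f = g"
  using bounded_clinear_ptensor_eqI[OF bounded_clinear_cdual_apply bounded_clinear_cdual_apply assms]
  by (simp add: cdual_apply_inject)

lemma norm_tensor_le: "norm (a \<otimes>\<^sub>p b) \<le> norm a * norm b"
  by (simp add: tensor_def norm_ptensor_of proj_norm_atensor_le)

text \<open>Elementary tensors suffice for norm estimates: lifting the bilinear form behind
  \<open>f\<close> keeps the constant \<open>K\<close>, and by uniqueness the lift is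
  \<open>f\<close> itself.\<close>

lemma norm_cdual_ptensor_bound:
  fixes f :: "('a::complex_normed_vector, 'b::complex_normed_vector) ptensor cdual"
  assumes "K \<ge> 0" "\<And>a b. norm (cdual_apply f (a \<otimes>\<^sub>p b)) \<le> K * (norm a * norm b)"
  shows "norm f \<le> K"
proof -
  interpret bounded_bilinear "(\<otimes>\<^sub>p) :: 'a \<Rightarrow> 'b \<Rightarrow> _"
    using bounded_cbilinear_tensor[where 'a = 'a and 'b = 'b] by (simp add: bounded_cbilinear_def)
  have "bounded_bilinear (\<lambda>a b. cdual_apply f (a \<otimes>\<^sub>p b))"
  proof
    show "\<exists>K. \<forall>a b. norm (cdual_apply f (a \<otimes>\<^sub>p b)) \<le> norm a * norm b * K"
      using assms(2) by (auto simp: mult.commute)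
  qed (simp_all add: add_left add_right scaleR_left scaleR_right cdual_apply_add
      bounded_linear.linear[OF bounded_linear_cdual_apply] linear_scale)
  then have "bounded_cbilinear (\<lambda>a b. cdual_apply f (a \<otimes>\<^sub>p b))"
    using bounded_cbilinear_tensor[where 'a = 'a and 'b = 'b]
    by (simp add: bounded_cbilinear_def cdual_apply_scaleC scaleC_complex_def)
  from tensor_lift_ex[OF this assms] obtain T where T: "bounded_clinear T"
    "\<And>a b. T (a \<otimes>\<^sub>p b) = cdual_apply f (a \<otimes>\<^sub>p b)" "\<And>u. norm (T u) \<le> K * norm u"
    by blast
  from bounded_clinear_ptensor_eqI[OF T(1) bounded_clinear_cdual_apply T(2)]
  have "T = cdual_apply f" .
  with T(3) assms(1) show ?thesis by (auto intro: norm_cdual_bound)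
qed

definition cdual_tensor ::
    "'a::complex_normed_vector cdual \<Rightarrow> 'b::complex_normed_vector cdual \<Rightarrow> ('a, 'b) ptensor cdual"
  where "cdual_tensor f g = Cdual (tensor_lift (\<lambda>a b. cdual_apply f a * cdual_apply g b))"

lemma cdual_apply_cdual_tensor:
  "cdual_apply (cdual_tensor f g) (a \<otimes>\<^sub>p b) = cdual_apply f a * cdual_apply g b"
proof -
  have *: "bounded_cbilinear (\<lambda>a b. cdual_apply f a * cdual_apply g b)"
    by (intro bounded_cbilinear_compose[OF bounded_cbilinear_mult] bounded_clinear_cdual_apply)
  show ?thesis
    by (simp add: cdual_tensor_def cdual_apply_Cdual bounded_clinear_tensor_lift[OF *]
        tensor_lift_tensor[OF *])
qed

lemma cdual_apply_bidual_left:
  assumes "bounded_clinear (l a)"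
  shows "cdual_apply (bidual_left l a m) f = cdual_apply m (adjoint_map (l a) f)"
  using assms
  by (simp add: bidual_left_def dual_left_def dual_right_def cdual_apply_adjoint_map
      bounded_clinear_adjoint_map)

lemma cdual_apply_bidual_right:
  assumes "bounded_clinear (\<lambda>x. r x a)"
  shows "cdual_apply (bidual_right r m a) f = cdual_apply m (adjoint_map (\<lambda>x. r x a) f)"
  using assms
  by (simp add: bidual_right_def dual_left_def dual_right_def cdual_apply_adjoint_map
      bounded_clinear_adjoint_map)

section \<open>An obstruction to Johnson pseudo-contractibility\<close>

text \<open>These conditions pass from an algebra to its second dual (see \<open>second_dual\<close>
  below), so a single argument refutes Johnson pseudo-contractibility for both.\<close>

locale characters_of_bounded_variation =
  fixes \<phi> :: "nat \<Rightarrow> 'a::complex_banach_algebra cdual" and u :: 'a and K :: real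
  assumes inj: "inj \<phi>"
    and mult: "cdual_apply (\<phi> n) (x * y) = cdual_apply (\<phi> n) x * cdual_apply (\<phi> n) y"
    and unit: "cdual_apply (\<phi> n) u = 1"
    and variation: "(\<Sum>i<N. norm (cdual_apply (\<phi> (Suc i) - \<phi> i) x)) \<le> K * norm x"
begin

lemma K_nonneg: "K \<ge> 0"
proof -
  have "u \<noteq> 0"
    using unit[of 0] linear_0[OF bounded_linear.linear[OF bounded_linear_cdual_apply[of "\<phi> 0"]]] by auto
  then show ?thesis
    \<comment> \<open>The empty sum gives \<open>0 \<le> K * norm u\<close>.\<close>
    using variation[where N = 0 and x = u] by (simp add: zero_le_mult_iff)
qed

text \<open>Telescoping from \<open>\<phi> 0\<close>. Uniformity in \<open>n\<close> lets one
  \<open>m\<close> control all diagonal values at once.\<close>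

lemma norm_le: "norm (\<phi> n) \<le> norm (\<phi> 0) + K"
proof -
  have "norm (\<phi> n - \<phi> 0) \<le> K"
  proof (rule norm_cdual_bound[OF K_nonneg])
    fix x
    have "\<phi> n - \<phi> 0 = (\<Sum>i<n. \<phi> (Suc i) - \<phi> i)"
      by (simp add: sum_lessThan_telescope)
    then have "norm (cdual_apply (\<phi> n - \<phi> 0) x) \<le> (\<Sum>i<n. norm (cdual_apply (\<phi> (Suc i) - \<phi> i) x))"
      by (simp only: sum_cdual_apply norm_sum)
    also note variation
    finally show "norm (cdual_apply (\<phi> n - \<phi> 0) x) \<le> K * norm x" .
  qed
  then show ?thesis
    using norm_triangle_ineq[of "\<phi> 0" "\<phi> n - \<phi> 0"] by simp
qed

text \<open>The functional is an eigenvector of the adjoints of both actions of \<open>a\<close>,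
  with eigenvalues \<open>\<phi> i\<close> and \<open>\<phi> j\<close> at \<open>a\<close>; choose
  \<open>a\<close> where these differ.\<close>

lemma commuting_tensor_eq_0:
  assumes m: "\<And>a. bidual_left tensor_left a m = bidual_right tensor_right m a" and "i \<noteq> j"
  shows "cdual_apply m (cdual_tensor (\<phi> i) (\<phi> j)) = 0"
proof -
  let ?\<psi> = "cdual_tensor (\<phi> i) (\<phi> j)"
  obtain a where a: "cdual_apply (\<phi> i) a \<noteq> cdual_apply (\<phi> j) a"
    using inj \<open>i \<noteq> j\<close> by (metis cdual_eqI injD)
  have "adjoint_map (tensor_left a) ?\<psi> = cdual_apply (\<phi> i) a *\<^sub>C ?\<psi>"
    by (rule cdual_ptensor_eqI)
      (simp add: cdual_apply_adjoint_map bounded_clinear_tensor_left tensor_left_tensor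
        cdual_apply_cdual_tensor scaleC_cdual.rep_eq mult)
  moreover have "adjoint_map (\<lambda>x. tensor_right x a) ?\<psi> = cdual_apply (\<phi> j) a *\<^sub>C ?\<psi>"
    by (rule cdual_ptensor_eqI)
      (simp add: cdual_apply_adjoint_map bounded_clinear_tensor_right tensor_right_tensor
        cdual_apply_cdual_tensor scaleC_cdual.rep_eq mult)
  ultimately have "cdual_apply (\<phi> i) a * cdual_apply m ?\<psi> = cdual_apply (\<phi> j) a * cdual_apply m ?\<psi>"
    using arg_cong[OF m[of a], of "\<lambda>F. cdual_apply F ?\<psi>"]
    by (simp add: cdual_apply_bidual_left cdual_apply_bidual_right bounded_clinear_tensor_left
        bounded_clinear_tensor_right cdual_apply_scaleC)
  with a show ?thesis by simp
qed

text \<open>On an elementary tensor the sum is a diagonal part of a product of two sums of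
  nonnegative terms, each bounded by \<open>variation\<close>; hence the bound does not grow with
  \<open>N\<close>.\<close>

lemma norm_sum_tensor_le:
  "norm (\<Sum>i<N. cdual_tensor (\<phi> (Suc i) - \<phi> i) (\<phi> (Suc i) - \<phi> i)) \<le> K * K"
proof (rule norm_cdual_ptensor_bound)
  fix a b
  let ?\<epsilon> = "\<lambda>i x. norm (cdual_apply (\<phi> (Suc i) - \<phi> i) x)"
  have "norm (cdual_apply (\<Sum>i<N. cdual_tensor (\<phi> (Suc i) - \<phi> i) (\<phi> (Suc i) - \<phi> i)) (a \<otimes>\<^sub>p b))
      \<le> (\<Sum>i<N. ?\<epsilon> i a * ?\<epsilon> i b)"
    unfolding sum_cdual_apply cdual_apply_cdual_tensor by (rule sum_norm_le) (simp add: norm_mult)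
  also have "\<dots> \<le> (\<Sum>i<N. ?\<epsilon> i a * (\<Sum>j<N. ?\<epsilon> j b))"
    by (intro sum_mono mult_left_mono member_le_sum) auto
  also have "\<dots> = (\<Sum>i<N. ?\<epsilon> i a) * (\<Sum>j<N. ?\<epsilon> j b)"
    by (simp add: sum_distrib_right)
  also have "\<dots> \<le> (K * norm a) * (K * norm b)"
    by (intro mult_mono variation mult_nonneg_nonneg K_nonneg sum_nonneg) auto
  finally show "norm (cdual_apply (\<Sum>i<N. cdual_tensor (\<phi> (Suc i) - \<phi> i) (\<phi> (Suc i) - \<phi> i)) (a \<otimes>\<^sub>p b))
      \<le> K * K * (norm a * norm b)"
    by (simp add: mult_ac)
qed (simp add: K_nonneg)

theorem not_johnson_pseudo_contractible: "\<not> johnson_pseudo_contractible TYPE('a)"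
proof
  assume "johnson_pseudo_contractible TYPE('a)"
  then obtain \<F> :: "('a, 'a) ptensor cdual cdual filter" where \<F>: "\<F> \<noteq> bot"
    "\<forall>\<^sub>F m in \<F>. \<forall>a. bidual_left tensor_left a m = bidual_right tensor_right m a"
    "((\<lambda>m. bidual_right (*) (adjoint_map (adjoint_map mult_map) m) u - bidual_embed u) \<longlongrightarrow> 0) \<F>"
    unfolding johnson_pseudo_contractible_def by blast
  \<comment> \<open>The summand 1 makes \<open>C\<close> positive; error \<open>1 / (2 * C)\<close>
    at \<open>u\<close> becomes error at most 1/2 under every \<open>\<phi> n\<close>.\<close>
  define C where "C = norm (\<phi> 0) + K + 1"
  have C: "C > 0" "norm (\<phi> n) \<le> C" for n
    using K_nonneg norm_ge_zero[of "\<phi> 0"] norm_le[of n] unfolding C_def by linarith+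
  have "\<forall>\<^sub>F m in \<F>. norm (bidual_right (*) (adjoint_map (adjoint_map mult_map) m) u - bidual_embed u) < 1 / (2 * C)"
    using tendstoD[OF \<F>(3), of "1 / (2 * C)"] C(1) by (simp add: dist_norm)
  from eventually_happens'[OF \<F>(1) eventually_conj[OF \<F>(2) this]]
  obtain m where comm: "\<And>a. bidual_left tensor_left a m = bidual_right tensor_right m a"
    and near: "norm (bidual_right (*) (adjoint_map (adjoint_map mult_map) m) u - bidual_embed u) < 1 / (2 * C)"
    by blast
  let ?\<psi> = "\<lambda>i j. cdual_tensor (\<phi> i) (\<phi> j)"
  have diag: "Re (cdual_apply m (?\<psi> i i)) \<ge> 1 / 2" for i
  proof -
    let ?R = "bidual_right (*) (adjoint_map (adjoint_map mult_map) m) u"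
    have lin: "bounded_clinear (\<lambda>x. x * u)"
      by (rule bounded_cbilinear_left[OF bounded_cbilinear_mult])
    \<comment> \<open>Both adjoints are explicit on a character, so pairing \<open>?R\<close> with
      \<open>\<phi> i\<close> reads off the diagonal value of \<open>m\<close>.\<close>
    have "adjoint_map (\<lambda>x. x * u) (\<phi> i) = \<phi> i"
      by (rule cdual_eqI) (simp add: cdual_apply_adjoint_map lin mult unit)
    moreover have "adjoint_map mult_map (\<phi> i) = ?\<psi> i i"
      by (rule cdual_ptensor_eqI)
        (simp add: cdual_apply_adjoint_map bounded_clinear_mult_map mult_map_tensor
          cdual_apply_cdual_tensor mult)
    ultimately have "cdual_apply (?R - bidual_embed u) (\<phi> i) = cdual_apply m (?\<psi> i i) - 1"
      by (simp add: minus_cdual.rep_eq cdual_apply_bidual_right lin cdual_apply_adjoint_map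
          bounded_clinear_adjoint_map bounded_clinear_mult_map cdual_apply_bidual_embed unit)
    then have "norm (cdual_apply m (?\<psi> i i) - 1) \<le> norm (?R - bidual_embed u) * norm (\<phi> i)"
      by (metis norm_cdual_apply_le)
    also have "\<dots> \<le> 1 / (2 * C) * C"
      using near C by (intro mult_mono) auto
    also have "\<dots> = 1 / 2" using C(1) by simp
    finally show ?thesis
      using abs_Re_le_cmod[of "cdual_apply m (?\<psi> i i) - 1"] by simp
  qed
  obtain N :: nat where N: "real N > norm m * (K * K)"
    using reals_Archimedean2 by blast
  define f where "f = (\<Sum>i<N. cdual_tensor (\<phi> (Suc i) - \<phi> i) (\<phi> (Suc i) - \<phi> i))"
  have expand: "cdual_tensor (\<phi> (Suc i) - \<phi> i) (\<phi> (Suc i) - \<phi> i) =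
      ?\<psi> (Suc i) (Suc i) - ?\<psi> (Suc i) i - ?\<psi> i (Suc i) + ?\<psi> i i" for i
    by (rule cdual_ptensor_eqI)
      (simp add: cdual_apply_cdual_tensor minus_cdual.rep_eq plus_cdual.rep_eq algebra_simps)
  \<comment> \<open>The mixed terms vanish because \<open>Suc i \<noteq> i\<close>; the two
    remaining ones contribute at least 1/2 + 1/2.\<close>
  have "cdual_apply m f = (\<Sum>i<N. cdual_apply m (?\<psi> (Suc i) (Suc i)) + cdual_apply m (?\<psi> i i))"
    by (simp add: f_def expand cdual_apply_sum cdual_apply_diff cdual_apply_add
        commuting_tensor_eq_0[OF comm])
  then have "Re (cdual_apply m f) = (\<Sum>i<N. Re (cdual_apply m (?\<psi> (Suc i) (Suc i))) + Re (cdual_apply m (?\<psi> i i)))"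
    by simp
  also have "\<dots> \<ge> (\<Sum>i<N. 1)"
  proof (rule sum_mono)
    show "1 \<le> Re (cdual_apply m (?\<psi> (Suc i) (Suc i))) + Re (cdual_apply m (?\<psi> i i))" for i
      using diag[of i] diag[of "Suc i"] by linarith
  qed
  finally have "real N \<le> norm (cdual_apply m f)"
    using complex_Re_le_cmod[of "cdual_apply m f"] by simp
  also have "\<dots> \<le> norm m * norm f" by (rule norm_cdual_apply_le)
  also have "\<dots> \<le> norm m * (K * K)"
    unfolding f_def by (intro mult_left_mono norm_sum_tensor_le) simp
  finally show False using N by simp
qed

end

section \<open>Extending characters to the second dual\<close>

lift_definition bidual_eval :: "'a::complex_banach_algebra cdual \<Rightarrow> 'a second_dual cdual"
  is "\<lambda>f F. cdual_apply (functional_of F) f"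
proof (rule bounded_clinearI)
  fix f :: "'a cdual" and F G :: "'a second_dual" and c
  show "cdual_apply (functional_of (F + G)) f = cdual_apply (functional_of F) f + cdual_apply (functional_of G) f"
    by (simp add: plus_second_dual.rep_eq plus_cdual.rep_eq)
  show "cdual_apply (functional_of (c *\<^sub>C F)) f = c *\<^sub>C cdual_apply (functional_of F) f"
    by (simp add: scaleC_second_dual.rep_eq scaleC_cdual.rep_eq scaleC_complex_def)
  show "norm (cdual_apply (functional_of F) f) \<le> norm F * norm f"
    by (simp add: norm_second_dual.rep_eq norm_cdual_apply_le)
qed

lemma bidual_eval_diff: "bidual_eval (f - g) = bidual_eval f - bidual_eval g"
  by (rule cdual_eqI) (simp add: bidual_eval.rep_eq minus_cdual.rep_eq cdual_apply_diff)

lemma bidual_eval_embed: "cdual_apply (bidual_eval f) (Second_dual (bidual_embed x)) = cdual_apply f x"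
  by (simp add: bidual_eval.rep_eq Second_dual_inverse cdual_apply_bidual_embed)

text \<open>For multiplicative \<open>f\<close>, every module translate of \<open>f\<close> is a
  scalar multiple of \<open>f\<close>, so \<open>arens_functional H f\<close> is \<open>H(f)\<close>
  times \<open>f\<close>.\<close>

lemma bidual_eval_mult:
  assumes "\<And>x y. cdual_apply f (x * y) = cdual_apply f x * cdual_apply f y"
  shows "cdual_apply (bidual_eval f) (F * G) = cdual_apply (bidual_eval f) F * cdual_apply (bidual_eval f) G"
proof -
  have fm: "functional_mult f a = cdual_apply f a *\<^sub>C f" for a
    by (rule cdual_eqI) (simp add: cdual_apply_functional_mult scaleC_cdual.rep_eq assms)
  have "arens_functional H f = cdual_apply H f *\<^sub>C f" for H
    by (rule cdual_eqI)
      (simp add: cdual_apply_arens_functional fm cdual_apply_scaleC scaleC_cdual.rep_eq)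
  then show ?thesis
    by (simp add: bidual_eval.rep_eq times_second_dual.rep_eq cdual_apply_arens_mult cdual_apply_scaleC)
qed

lemma (in characters_of_bounded_variation) second_dual:
  "characters_of_bounded_variation (\<lambda>n. bidual_eval (\<phi> n)) (Second_dual (bidual_embed u)) K"
proof
  show "inj (\<lambda>n. bidual_eval (\<phi> n))"
  proof (rule injI)
    fix i j assume "bidual_eval (\<phi> i) = bidual_eval (\<phi> j)"
    then have "\<phi> i = \<phi> j" by (metis bidual_eval_embed cdual_eqI)
    then show "i = j" using inj by (simp add: inj_eq)
  qed
  show "cdual_apply (bidual_eval (\<phi> n)) (F * G) = cdual_apply (bidual_eval (\<phi> n)) F * cdual_apply (bidual_eval (\<phi> n)) G" for n F G
    by (rule bidual_eval_mult) (rule mult)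
  show "cdual_apply (bidual_eval (\<phi> n)) (Second_dual (bidual_embed u)) = 1" for n
    by (simp add: bidual_eval_embed unit)
  show "(\<Sum>i<N. norm (cdual_apply (bidual_eval (\<phi> (Suc i)) - bidual_eval (\<phi> i)) F)) \<le> K * norm F" for N F
  proof -
    define z where "z i = cdual_apply (functional_of F) (\<phi> (Suc i) - \<phi> i)" for i
    \<comment> \<open>Conjugate phases turn the sum of moduli into the single value of
      \<open>F\<close> at \<open>g\<close>. As the coefficients have modulus at most 1, the original
      \<open>variation\<close> bounds the norm of \<open>g\<close>.\<close>
    define g where "g = (\<Sum>i<N. cnj (sgn (z i)) *\<^sub>C (\<phi> (Suc i) - \<phi> i))"
    have "norm g \<le> K"
    proof (rule norm_cdual_bound[OF K_nonneg])
      fix x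
      have "norm (cdual_apply g x) \<le> (\<Sum>i<N. norm (cdual_apply (\<phi> (Suc i) - \<phi> i) x))"
        unfolding g_def sum_cdual_apply
        by (rule sum_norm_le) (auto simp: scaleC_cdual.rep_eq norm_mult norm_sgn)
      also note variation
      finally show "norm (cdual_apply g x) \<le> K * norm x" .
    qed
    have sgn: "cnj (sgn w) * w = of_real (norm w)" for w
    proof (cases "w = 0")
      case False
      have "cnj w * w = of_real (norm w) * of_real (norm w)"
        by (metis complex_norm_square mult.commute power2_eq_square of_real_power)
      then show ?thesis using False by (simp add: sgn_eq field_simps)
    qed simp
    have "cdual_apply (functional_of F) g = of_real (\<Sum>i<N. norm (z i))"
      by (simp add: g_def cdual_apply_sum cdual_apply_scaleC sgn flip: z_def)
    then have "(\<Sum>i<N. norm (z i)) = norm (cdual_apply (functional_of F) g)"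
      by (simp add: sum_nonneg del: of_real_sum)
    also have "\<dots> \<le> norm F * norm g"
      by (simp add: norm_second_dual.rep_eq norm_cdual_apply_le)
    also have "\<dots> \<le> norm F * K"
      using \<open>norm g \<le> K\<close> by (rule mult_left_mono) simp
    finally show ?thesis
      by (simp add: z_def mult.commute bidual_eval.rep_eq flip: bidual_eval_diff)
  qed
qed

section \<open>A criterion for pseudo-amenability\<close>

text \<open>Stated for abstract \<open>g\<close> so that it serves the semigroup algebra and its
  unitization alike. The approximate diagonal is the sequence \<open>d\<close> below.\<close>

lemma pseudo_amenable_if_max_semigroup:
  fixes g :: "nat \<Rightarrow> 'a::complex_banach_algebra"
  assumes mult: "\<And>i j. g i * g j = g (max i j)"
    and unit: "\<And>a. g 0 * a = a"
    and norm: "\<And>i. norm (g i) \<le> K"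
    and dense: "\<And>a. \<exists>c. (\<lambda>k. c k *\<^sub>C g k) sums a"
  shows "pseudo_amenable TYPE('a)"
proof -
  define e where "e i = g i - g (Suc i)" for i
  define d where "d n = (\<Sum>i<n. e i \<otimes>\<^sub>p e i) + g n \<otimes>\<^sub>p g n" for n
  have tensor_lin: "bounded_clinear (\<lambda>a :: 'a. a \<otimes>\<^sub>p b)" "bounded_clinear (\<lambda>a :: 'a. b \<otimes>\<^sub>p a)" for b :: 'a
    by (rule bounded_cbilinear_left[OF bounded_cbilinear_tensor]
        bounded_cbilinear_right[OF bounded_cbilinear_tensor])+
  have mult_lin: "bounded_clinear (\<lambda>a. a * b)" "bounded_clinear (\<lambda>a. b * a)" for b :: 'a
    by (rule bounded_cbilinear_left[OF bounded_cbilinear_mult]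
        bounded_cbilinear_right[OF bounded_cbilinear_mult])+
  have K: "K \<ge> 0" using norm[of 0] norm_ge_zero[of "g 0"] by linarith

  \<comment> \<open>The commutator of \<open>a\<close> with \<open>x \<otimes>\<^sub>p x\<close>. It
    is linear and continuous in \<open>a\<close>, so expansions in the \<open>g k\<close> determine
    it.\<close>
  define C where "C x a = (a * x) \<otimes>\<^sub>p x - x \<otimes>\<^sub>p (x * a)" for x a :: 'a
  have C_lin: "bounded_clinear (C x)" for x
  proof -
    have "bounded_clinear (\<lambda>a. (a * x) \<otimes>\<^sub>p x)" "bounded_clinear (\<lambda>a. x \<otimes>\<^sub>p (x * a))"
      by (rule bounded_clinear_compose[OF tensor_lin(1) mult_lin(1)]
          bounded_clinear_compose[OF tensor_lin(2) mult_lin(2)])+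
    then show ?thesis
      by (auto simp: bounded_clinear_def C_def[abs_def] scaleC_diff_right intro: bounded_linear_sub)
  qed
  have C_sums: "(\<lambda>k. c k *\<^sub>C C x (g k)) sums C x a" if "(\<lambda>k. c k *\<^sub>C g k) sums a" for c x a
    using bounded_linear.sums[OF bounded_clinear_linear[OF C_lin] that]
    by (simp add: bounded_clinear_scaleC[OF C_lin])
  \<comment> \<open>Each \<open>g k\<close> acts on \<open>e i\<close> from either side by the same
    scalar, 1 or 0, so these commutators vanish and only that of \<open>g n\<close> survives in
    \<open>comm\<close>.\<close>
  have "g k * e i = (if k \<le> i then e i else 0)" "e i * g k = (if k \<le> i then e i else 0)" for k i
    by (auto simp: e_def algebra_simps mult max_def not_less_eq_eq dest: le_antisym)
  then have "C (e i) (g k) = 0" for k i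
    using linear_0[OF bounded_linear.linear[OF bounded_clinear_linear[OF tensor_lin(1)]]]
      linear_0[OF bounded_linear.linear[OF bounded_clinear_linear[OF tensor_lin(2)]]]
    by (simp add: C_def)
  then have C_e: "C (e i) a = 0" for i a
    using dense[of a] C_sums[of _ a "e i"] by (auto simp: sums_iff)
  have comm: "tensor_left a (d n) - tensor_right (d n) a = C (g n) a" for a n
  proof -
    note lin = bounded_linear.linear[OF bounded_clinear_linear[OF bounded_clinear_tensor_left[of a]]]
      bounded_linear.linear[OF bounded_clinear_linear[OF bounded_clinear_tensor_right[of a]]]
    have "tensor_left a (d n) - tensor_right (d n) a = (\<Sum>i<n. C (e i) a) + C (g n) a"
      by (simp add: d_def C_def linear_add[OF lin(1)] linear_add[OF lin(2)] linear_sum[OF lin(1)]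
          linear_sum[OF lin(2)] tensor_left_tensor tensor_right_tensor sum_subtractf)
    then show ?thesis by (simp add: C_e)
  qed
  have C_bound: "norm (C (g n) a) \<le> 2 * K * K * norm a" for n a
  proof -
    have gg: "norm (g n) * norm (g n) \<le> K * K"
      by (intro mult_mono norm K) simp
    have "norm (C (g n) a) \<le> norm (a * g n) * norm (g n) + norm (g n) * norm (g n * a)"
      unfolding C_def by (intro order_trans[OF norm_triangle_ineq4] add_mono norm_tensor_le)
    also have "\<dots> \<le> (norm a * norm (g n)) * norm (g n) + norm (g n) * (norm (g n) * norm a)"
      by (intro add_mono mult_right_mono mult_left_mono norm_mult_ineq) auto
    also have "\<dots> = 2 * norm a * (norm (g n) * norm (g n))" by (simp add: algebra_simps)
    also have "\<dots> \<le> 2 * norm a * (K * K)" by (intro mult_left_mono gg) simp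
    finally show ?thesis by (simp add: mult_ac)
  qed
  have lim: "(\<lambda>n. C (g n) a) \<longlonglongrightarrow> 0" for a
  proof -
    obtain c where c: "(\<lambda>k. c k *\<^sub>C g k) sums a" using dense by blast
    \<comment> \<open>Index \<open>n\<close> is included: \<open>g k\<close> with
      \<open>k \<le> n\<close> is absorbed by \<open>g n\<close>, so \<open>C (g n)\<close> kills
      \<open>p n\<close>. The uniform bound \<open>C_bound\<close> then applies to the tail
      \<open>a - p n\<close>.\<close>
    define p where "p n = (\<Sum>k<Suc n. c k *\<^sub>C g k)" for n
    have p: "(\<lambda>n. a - p n) \<longlonglongrightarrow> 0"
      using tendsto_diff[OF tendsto_const LIMSEQ_Suc[OF c[unfolded sums_def]], of a] unfolding p_def by simp
    have "C (g n) (p n) = 0" for n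
    proof -
      note lin = bounded_linear.linear[OF bounded_clinear_linear[OF C_lin]]
      have "C (g n) (g k) = 0" if "k < Suc n" for k
        using that by (simp add: C_def mult max_absorb1 max_absorb2 less_Suc_eq_le)
      then show ?thesis
        by (simp add: p_def linear_sum[OF lin] bounded_clinear_scaleC[OF C_lin] del: sum.lessThan_Suc)
    qed
    then have eq: "C (g n) a = C (g n) (a - p n)" for n
      by (simp add: linear_diff[OF bounded_linear.linear[OF bounded_clinear_linear[OF C_lin]]])
    show ?thesis
    proof (rule Lim_null_comparison[OF always_eventually])
      show "\<forall>n. norm (C (g n) a) \<le> 2 * K * K * norm (a - p n)"
        using C_bound by (subst eq) blast
      show "(\<lambda>n. 2 * K * K * norm (a - p n)) \<longlonglongrightarrow> 0"
        by (intro tendsto_mult_right_zero tendsto_norm_zero p)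
    qed
  qed
  have unit_d: "mult_map (d n) = g 0" for n
  proof -
    note lin = bounded_linear.linear[OF bounded_clinear_linear[OF bounded_clinear_mult_map]]
    \<comment> \<open>Idempotence makes the sum telescope to the unit \<open>g 0\<close>
      exactly.\<close>
    have "e i * e i = e i" for i
      by (simp add: e_def algebra_simps mult)
    then have "mult_map (d n) = (\<Sum>i<n. g i - g (Suc i)) + g n"
      by (simp add: d_def linear_add[OF lin] linear_sum[OF lin] mult_map_tensor mult e_def)
    then show ?thesis by (simp add: sum_lessThan_telescope')
  qed
  show ?thesis
    unfolding pseudo_amenable_def
    by (rule exI[of _ "filtermap d sequentially"])
      (simp add: filtermap_bot_iff filterlim_filtermap comm lim unit_d unit)
qed

section \<open>The semigroup algebra\<close>

lemma norm_l1_delta: "norm (l1_delta s) = 1"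
proof -
  have "(\<Sum>\<^sub>\<infinity>t. norm (of_bool (t = s) :: complex)) = (\<Sum>\<^sub>\<infinity>t\<in>{s}. 1 :: real)"
    by (rule infsum_cong_neutral) auto
  then show ?thesis by (simp add: norm_l1.rep_eq l1_delta.rep_eq)
qed

lemma bounded_clinear_l1_apply: "bounded_clinear (\<lambda>f. l1_apply f s)"
  by (rule bounded_clinearI[where K = 1])
    (auto simp: plus_l1.rep_eq scaleC_l1.rep_eq scaleC_complex_def norm_l1_apply_le)

text \<open>Absolute summability gives some sum in the Banach space; the continuous coordinate
  functionals identify it as \<open>f\<close>.\<close>

lemma has_sum_l1_delta: "((\<lambda>s. l1_apply f s *\<^sub>C l1_delta s) has_sum f) UNIV"
proof -
  let ?h = "\<lambda>s. l1_apply f s *\<^sub>C l1_delta s"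
  have "(\<lambda>s. norm (?h s)) summable_on UNIV"
    by (simp add: norm_scaleC norm_l1_delta l1_abs_summable)
  then have "?h summable_on UNIV" by (rule abs_summable_summable)
  then have h: "(?h has_sum infsum ?h UNIV) UNIV" by simp
  have "infsum ?h UNIV = f"
  proof (rule l1_eqI)
    fix s
    have "((\<lambda>t. l1_apply (?h t) s) has_sum l1_apply (infsum ?h UNIV) s) UNIV"
      using has_sum_bounded_linear[OF bounded_clinear_linear[OF bounded_clinear_l1_apply] h]
      by (simp add: o_def)
    moreover have "((\<lambda>t. l1_apply (?h t) s) has_sum l1_apply f s) UNIV"
      using has_sum_finite[of "{s}" "\<lambda>t. l1_apply (?h t) s"]
      by (subst has_sum_cong_neutral[where S = UNIV and T = "{s}" and g = "\<lambda>t. l1_apply (?h t) s"])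
        (auto simp: scaleC_l1.rep_eq l1_delta.rep_eq)
    ultimately show "l1_apply (infsum ?h UNIV) s = l1_apply f s"
      by (rule has_sum_unique)
  qed
  with h show ?thesis by simp
qed

lemma bounded_clinear_l1_eqI:
  assumes S: "bounded_clinear S" and T: "bounded_clinear T"
    and eq: "\<And>s. S (l1_delta s) = T (l1_delta s)"
  shows "S = T"
proof
  fix f
  have "((\<lambda>s. R (l1_apply f s *\<^sub>C l1_delta s)) has_sum R f) UNIV" if "bounded_clinear R"
    for R :: "'a l1 \<Rightarrow> 'b"
    using has_sum_bounded_linear[OF bounded_clinear_linear[OF that] has_sum_l1_delta]
    by (simp add: o_def)
  from this[OF S] this[OF T] show "S f = T f"
    by (simp add: bounded_clinear_scaleC[OF S] bounded_clinear_scaleC[OF T] eq has_sum_unique)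
qed

lemma sums_l1_delta_nat_vee:
  "(\<lambda>k. l1_apply f (Vee k) *\<^sub>C l1_delta (Vee k)) sums f"
proof -
  have "bij_betw Vee UNIV UNIV"
    by (auto simp: bij_betw_def inj_on_def image_def) (metis nat_vee.exhaust)
  from has_sum_reindex_bij_betw[OF this, of "\<lambda>s. l1_apply f s *\<^sub>C l1_delta s"] has_sum_l1_delta[of f]
  show ?thesis by (auto intro: has_sum_imp_sums)
qed

section \<open>Characters given by initial sums\<close>

lift_definition initial_sum :: "nat \<Rightarrow> nat_vee l1 cdual"
  is "\<lambda>n f. \<Sum>k\<le>n. l1_apply f (Vee k)"
proof (rule bounded_clinearI)
  fix n and f :: "nat_vee l1"
  have "norm (\<Sum>k\<le>n. l1_apply f (Vee k)) \<le> (\<Sum>s\<in>Vee ` {..n}. norm (l1_apply f s))"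
    by (simp add: sum.reindex inj_on_def norm_sum)
  also have "\<dots> \<le> norm f" by (rule norm_sum_l1_le) simp
  finally show "norm (\<Sum>k\<le>n. l1_apply f (Vee k)) \<le> norm f * 1" by simp
qed (auto simp: plus_l1.rep_eq scaleC_l1.rep_eq scaleC_complex_def sum.distrib sum_distrib_left)

lemma initial_sum_delta: "cdual_apply (initial_sum n) (l1_delta (Vee k)) = of_bool (k \<le> n)"
  by (simp add: initial_sum.rep_eq l1_delta.rep_eq of_bool_def)

text \<open>A maximum is at most \<open>n\<close> iff both arguments are, which settles point
  masses; continuity extends this to one factor, then to the other.\<close>

lemma initial_sum_mult:
  "cdual_apply (initial_sum n) (f * g) = cdual_apply (initial_sum n) f * cdual_apply (initial_sum n) g"
proof -
  let ?\<phi> = "cdual_apply (initial_sum n)"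
  note compose = bounded_clinear_compose[OF bounded_clinear_cdual_apply]
  note mult = bounded_cbilinear_left[OF bounded_cbilinear_mult]
    bounded_cbilinear_right[OF bounded_cbilinear_mult]
  have delta: "?\<phi> (l1_delta s * l1_delta t) = ?\<phi> (l1_delta s) * ?\<phi> (l1_delta t)" for s t
    by (cases s; cases t) (simp add: l1_delta_mult initial_sum_delta)
  have "(\<lambda>g. ?\<phi> (l1_delta s * g)) = (\<lambda>g. ?\<phi> (l1_delta s) * ?\<phi> g)" for s
    by (rule bounded_clinear_l1_eqI)
      (rule compose[OF mult(2)] bounded_clinear_compose[OF mult(2) bounded_clinear_cdual_apply] delta)+
  then have "(\<lambda>f. ?\<phi> (f * g)) = (\<lambda>f. ?\<phi> f * ?\<phi> g)"
    by (intro bounded_clinear_l1_eqI compose[OF mult(1)]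
        bounded_clinear_compose[OF mult(1) bounded_clinear_cdual_apply]) (rule fun_cong)
  then show ?thesis by (rule fun_cong)
qed

interpretation nat_vee: characters_of_bounded_variation initial_sum "l1_delta (Vee 0)" 1
proof
  show "inj initial_sum"
  proof (rule injI)
    fix i j assume eq: "initial_sum i = initial_sum j"
    have "k \<le> i \<longleftrightarrow> k \<le> j" for k
      using initial_sum_delta[of i k] initial_sum_delta[of j k] by (auto simp: eq of_bool_def split: if_splits)
    then show "i = j" by (metis order_antisym order_refl)
  qed
  show "cdual_apply (initial_sum n) (f * g) = cdual_apply (initial_sum n) f * cdual_apply (initial_sum n) g" for n f g
    by (rule initial_sum_mult)
  show "cdual_apply (initial_sum n) (l1_delta (Vee 0)) = 1" for n
    by (simp add: initial_sum_delta)
  show "(\<Sum>i<N. norm (cdual_apply (initial_sum (Suc i) - initial_sum i) f)) \<le> 1 * norm f" for N f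
  proof -
    \<comment> \<open>The increment at \<open>i\<close> is the coordinate at
      \<open>Vee (Suc i)\<close>, so the total variation is part of the norm of
      \<open>f\<close>.\<close>
    have "(\<Sum>i<N. norm (cdual_apply (initial_sum (Suc i) - initial_sum i) f)) =
        (\<Sum>s\<in>(\<lambda>i. Vee (Suc i)) ` {..<N}. norm (l1_apply f s))"
      by (simp add: minus_cdual.rep_eq initial_sum.rep_eq sum.reindex inj_on_def)
    also have "\<dots> \<le> norm f" by (rule norm_sum_l1_le) simp
    finally show ?thesis by simp
  qed
qed

section \<open>Pseudo-amenability of the algebra and its unitization\<close>

lemma l1_delta_0_mult: "l1_delta (Vee 0) * f = f"
proof -
  have "(\<lambda>f. l1_delta (Vee 0) * f) = (\<lambda>f. f)"
  proof (rule bounded_clinear_l1_eqI[OF bounded_cbilinear_right[OF bounded_cbilinear_mult] bounded_clinear_id])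
    show "l1_delta (Vee 0) * l1_delta s = l1_delta s" for s
      by (cases s) (simp add: l1_delta_mult)
  qed
  then show ?thesis by (rule fun_cong)
qed

lemma pseudo_amenable_l1_nat_vee: "pseudo_amenable TYPE(nat_vee l1)"
proof (rule pseudo_amenable_if_max_semigroup)
  show "l1_delta (Vee i) * l1_delta (Vee j) = l1_delta (Vee (max i j))" for i j
    by (simp add: l1_delta_mult)
  show "\<exists>c. (\<lambda>k. c k *\<^sub>C l1_delta (Vee k)) sums f" for f
    by (rule exI[of _ "\<lambda>k. l1_apply f (Vee k)"]) (rule sums_l1_delta_nat_vee)
  show "norm (l1_delta (Vee i)) \<le> 1" for i
    by (simp add: norm_l1_delta)
qed (rule l1_delta_0_mult)

lemma approximately_amenable_l1_nat_vee: "approximately_amenable TYPE(nat_vee l1)"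
proof -
  \<comment> \<open>The adjoined unit takes index 0 and the point masses shift up by one, which
    again gives the max rule.\<close>
  define g where "g i = (case i of 0 \<Rightarrow> Unitization (0, 1) | Suc k \<Rightarrow> Unitization (l1_delta (Vee k), 0))" for i
  show ?thesis
    unfolding approximately_amenable_def
  proof (rule pseudo_amenable_if_max_semigroup)
    show "g i * g j = g (max i j)" for i j
      by (cases i; cases j) (simp_all add: g_def times_unitization.abs_eq l1_delta_mult)
    show "g 0 * x = x" for x
      by (cases x) (auto simp: g_def times_unitization.abs_eq)
    show "norm (g i) \<le> 1" for i
      by (cases i) (simp_all add: g_def norm_unitization.abs_eq norm_l1_delta)
    show "\<exists>c. (\<lambda>k. c k *\<^sub>C g k) sums x" for x
    proof -
      obtain f z where x: "x = Unitization (f, z)" by (cases x) auto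
      define c where "c i = (case i of 0 \<Rightarrow> z | Suc k \<Rightarrow> l1_apply f (Vee k))" for i
      have "bounded_linear (\<lambda>f :: nat_vee l1. Unitization (f, 0))"
        by (rule bounded_linear_intro[where K = 1])
          (simp_all add: plus_unitization.abs_eq scaleR_unitization.abs_eq norm_unitization.abs_eq)
      from bounded_linear.sums[OF this sums_l1_delta_nat_vee]
      have "(\<lambda>k. c (Suc k) *\<^sub>C g (Suc k)) sums Unitization (f, 0)"
        by (simp add: c_def g_def scaleC_unitization.abs_eq)
      then have "(\<lambda>k. c k *\<^sub>C g k) sums (Unitization (f, 0) + c 0 *\<^sub>C g 0)"
        by (rule sums_Suc)
      also have "Unitization (f, 0) + c 0 *\<^sub>C g 0 = x"
        by (simp add: c_def g_def x plus_unitization.abs_eq scaleC_unitization.abs_eq)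
      finally show ?thesis by blast
    qed
  qed
qed

theorem mainTheorem4:
  shows "\<not> johnson_pseudo_contractible TYPE(nat_vee l1) \<and>
    pseudo_amenable TYPE(nat_vee l1) \<and>
    approximately_amenable TYPE(nat_vee l1) \<and>
    \<not> johnson_pseudo_contractible TYPE(nat_vee l1 second_dual)"
  using nat_vee.not_johnson_pseudo_contractible pseudo_amenable_l1_nat_vee
    approximately_amenable_l1_nat_vee
    characters_of_bounded_variation.not_johnson_pseudo_contractible[OF nat_vee.second_dual]
  by blast

end
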